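(* Let $1\le r\le n-1$ with $\gcd(r,n)=1$ and let $w_{r,n}$ be the unique minimal element (for the Bruhat order) in $W^{S\setminus\{\alpha_{r}\}}$ such that $X(w_{r,n})^{ss}_{T}(\mathcal{L}(n\omega_{r}))\neq \emptyset$. Let $\mathrm{Peaks}(w_{r,n})=\{\alpha_{i_{j}}:1\leq j\leq l\}$ and let $T_{J}$ denote the subtorus of $T$ generated by $\lambda_{i_{j}}(\mathbb{G}_{m})$ $(1\le j\le l)$. Then $w_{r,n}$ is the unique minimal element of $W^{S\setminus\{\alpha_{r}\}}$ such that $X(w_{r,n})^{ss}_{T_{J}}(\mathcal{L}(n\omega_{r}))\neq \emptyset$.
   Context: $G=PSL(n,\mathbb{C})$, $T\subset B\subset G$ a maximal torus and Borel subgroup (say, images of diagonal and upper triangular matrices), $W$ the Weyl group, $S=\{\alpha_1,\dots,\alpha_{n-1}\}$ the simple roots, $s_i$ the simple reflections, $\omega_i$ the fundamental weights, and $\lambda_1,\dots,\lambda_{n-1}$ the one-parameter subgroups of $T$ dual to $S$: $\langle\alpha_i,\lambda_j\rangle=\delta_{ij}$. $P=P_{S\setminus\{\alpha_r\}}$ is the standard maximal parabolic with $G/P=G_{r,n}$ the Grassmannian. $W^{S\setminus\{\alpha_r\}}$ is the set of minimal length representatives of $W/W_{S\setminus\{\alpha_r\}}$, with the restricted Bruhat order; it is identified with increasing $r$-tuples $(w(1)<\dots<w(r))$ in $\{1,\dots,n\}$ with the componentwise order. $X(w)=\overline{BwP/P}$ is the Schubert variety. $\mathcal{L}(n\omega_r)$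 is the line bundle associated to the character $n\omega_r$ of $T$, i.e. $\mathcal{O}(n)$ for the Plücker embedding with its natural $G$-linearization. For a torus $H\subseteq T$, $X(w)^{ss}_H(\mathcal{L}(n\omega_r))$ is the set of $x\in X(w)$ for which some $H$-invariant section of some positive power of $\mathcal{L}(n\omega_r)$ on $X(w)$ does not vanish at $x$. It is known that there is a unique minimal $w\in W^{S\setminus\{\alpha_r\}}$ with $X(w)^{ss}_T(\mathcal{L}(n\omega_r))\ne\emptyset$; it is denoted $w_{r,n}$. Peaks: for $w\in W^{S\setminus\{\alpha_r\}}$, $\mathrm{Peaks}(w)$ is the set of simple roots $\alpha_i$ such that $s_i$ can occur as the leftmost factor of a reduced expression of $w$ (equivalently $\ell(s_iw)<\ell(w)$; in one-line notation, $i+1\in\{w(1),\dots,w(r)\}$ and $i\notin\{w(1),\dots,w(r)\}$). *)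

theory Defs
  imports
    "Jordan_Normal_Form.Determinant"
    "HOL-Algebra.Sym_Groups"
    "HOL-Algebra.Generated_Groups"
begin

section \<open>The Weyl group of type $A_{n-1}$\<close>

text \<open>
  The Weyl group is \<^term>\<open>sym_group n\<close>, the permutations of \<open>{1..n}\<close>.  The simple root
  \<open>\<alpha>\<^sub>i\<close> is represented by its index \<open>i \<in> {1..n-1}\<close>.
\<close>

definition simple_refl :: "nat \<Rightarrow> nat \<Rightarrow> nat" where
  "simple_refl i = Transposition.transpose i (i + 1)"

definition word_prod :: "nat list \<Rightarrow> nat \<Rightarrow> nat" where
  "word_prod is = foldr (\<lambda>i p. simple_refl i \<circ> p) is id"

definition expression :: "nat \<Rightarrow> nat list \<Rightarrow> (nat \<Rightarrow> nat) \<Rightarrow> bool" where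
  "expression n is w \<longleftrightarrow> set is \<subseteq> {1..n-1} \<and> word_prod is = w"

definition weyl_length :: "nat \<Rightarrow> (nat \<Rightarrow> nat) \<Rightarrow> nat" where
  "weyl_length n w = (LEAST k. \<exists>is. expression n is w \<and> length is = k)"

definition reduced_expression :: "nat \<Rightarrow> nat list \<Rightarrow> (nat \<Rightarrow> nat) \<Rightarrow> bool" where
  "reduced_expression n is w \<longleftrightarrow> expression n is w \<and> length is = weyl_length n w"

definition peaks :: "nat \<Rightarrow> (nat \<Rightarrow> nat) \<Rightarrow> nat set" where
  "peaks n w = {i. \<exists>is. reduced_expression n (i # is) w}"

definition reflections :: "nat \<Rightarrow> (nat \<Rightarrow> nat) set" where
  "reflections n = {x \<circ> simple_refl i \<circ> inv' x | x i. x \<in> carrier (sym_group n) \<and> i \<in> {1..n-1}}"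

definition bruhat_step :: "nat \<Rightarrow> (nat \<Rightarrow> nat) \<Rightarrow> (nat \<Rightarrow> nat) \<Rightarrow> bool" where
  "bruhat_step n u v \<longleftrightarrow>
     (\<exists>t \<in> reflections n. v = u \<circ> t) \<and> weyl_length n u < weyl_length n v"

definition bruhat_le :: "nat \<Rightarrow> (nat \<Rightarrow> nat) \<Rightarrow> (nat \<Rightarrow> nat) \<Rightarrow> bool" where
  "bruhat_le n = (bruhat_step n)\<^sup>*\<^sup>*"

definition parabolic_weyl :: "nat \<Rightarrow> nat \<Rightarrow> (nat \<Rightarrow> nat) set" where
  "parabolic_weyl n r = generate (sym_group n) (simple_refl ` ({1..n-1} - {r}))"

definition min_reps :: "nat \<Rightarrow> nat \<Rightarrow> (nat \<Rightarrow> nat) set" where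
  "min_reps n r = {w \<in> carrier (sym_group n).
     \<forall>v \<in> parabolic_weyl n r. weyl_length n w \<le> weyl_length n (w \<circ> v)}"

definition minimal_elements :: "('a \<Rightarrow> 'a \<Rightarrow> bool) \<Rightarrow> 'a set \<Rightarrow> 'a set" where
  "minimal_elements R A = {v \<in> A. \<forall>u \<in> A. R u v \<longrightarrow> u = v}"

definition unique_minimal :: "('a \<Rightarrow> 'a \<Rightarrow> bool) \<Rightarrow> 'a set \<Rightarrow> 'a \<Rightarrow> bool" where
  "unique_minimal R A w \<longleftrightarrow> minimal_elements R A = {w}"


section \<open>The group $PSL(n,\<complex>)$ and its subgroups\<close>

text \<open>Matrix positions are counted from \<open>0\<close>, permutations act on \<open>{1..n}\<close>.\<close>

definition SL :: "nat \<Rightarrow> complex mat monoid" where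
  "SL n = \<lparr>carrier = {A \<in> carrier_mat n n. det A = 1}, monoid.mult = (*), one = 1\<^sub>m n\<rparr>"

definition SL_centre :: "nat \<Rightarrow> complex mat set" where
  "SL_centre n = {c \<cdot>\<^sub>m 1\<^sub>m n | c. c ^ n = 1}"

definition PSL :: "nat \<Rightarrow> complex mat set monoid" where
  "PSL n = SL n Mod SL_centre n"

definition proj :: "nat \<Rightarrow> complex mat \<Rightarrow> complex mat set" where
  "proj n A = SL_centre n #>\<^bsub>SL n\<^esub> A"

lemma SL_group: "group (SL n)"
proof (rule groupI)
  fix A assume "A \<in> carrier (SL n)"
  then have A: "A \<in> carrier_mat n n" "det A = 1" by (auto simp: SL_def)
  have "adj_mat A * A = 1\<^sub>m n" "adj_mat A \<in> carrier_mat n n"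
    using adj_mat[OF A(1)] A(2) by auto
  moreover from this have "det (adj_mat A) = 1"
    using det_mult[of "adj_mat A" n A] A by simp
  ultimately show "\<exists>B \<in> carrier (SL n). B \<otimes>\<^bsub>SL n\<^esub> A = \<one>\<^bsub>SL n\<^esub>"
    by (auto simp: SL_def)
qed (auto simp: SL_def det_mult assoc_mult_mat[of _ n n _ n _ n])

lemma SL_centre_normal: "SL_centre n \<lhd> SL n"
proof -
  interpret group "SL n" by (rule SL_group)
  have sub: "SL_centre n \<subseteq> carrier (SL n)"
    by (auto simp: SL_centre_def SL_def)
  have scal: "(c \<cdot>\<^sub>m 1\<^sub>m n) * A = c \<cdot>\<^sub>m A" "A * (c \<cdot>\<^sub>m 1\<^sub>m n) = c \<cdot>\<^sub>m A"
    if "A \<in> carrier_mat n n" for c :: complex and A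
    using that by (auto simp: mult_smult_assoc_mat[of _ n n _ n] mult_smult_distrib[of _ n n _ n])
  have m: "x \<otimes>\<^bsub>SL n\<^esub> y \<in> SL_centre n" if "x \<in> SL_centre n" "y \<in> SL_centre n" for x y
  proof -
    from that obtain c d where "x = c \<cdot>\<^sub>m 1\<^sub>m n" "c ^ n = 1" "y = d \<cdot>\<^sub>m 1\<^sub>m n" "d ^ n = 1"
      by (auto simp: SL_centre_def)
    then show ?thesis
      by (auto simp: SL_centre_def SL_def scal power_mult_distrib intro!: exI[of _ "c * d"])
  qed
  have i: "inv\<^bsub>SL n\<^esub> x \<in> SL_centre n" if "x \<in> SL_centre n" for x
  proof -
    from that obtain c where c: "x = c \<cdot>\<^sub>m 1\<^sub>m n" "c ^ n = 1" by (auto simp: SL_centre_def)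
    let ?y = "inverse c \<cdot>\<^sub>m 1\<^sub>m n"
    have y: "?y \<in> SL_centre n" using c by (auto simp: SL_centre_def power_inverse)
    have "n = 0 \<or> c \<noteq> 0" using c(2) by (cases n) auto
    then have "?y \<otimes>\<^bsub>SL n\<^esub> x = \<one>\<^bsub>SL n\<^esub>"
      using c by (auto simp: SL_def scal)
    then have "inv\<^bsub>SL n\<^esub> x = ?y"
      using sub that y by (intro inv_equality) auto
    with y show ?thesis by simp
  qed
  have one: "\<one>\<^bsub>SL n\<^esub> \<in> SL_centre n"
    by (auto simp: SL_centre_def SL_def intro!: exI[of _ 1])
  have "subgroup (SL_centre n) (SL n)"
    using sub m i one by (intro subgroup.intro) auto
  moreover have "x \<otimes>\<^bsub>SL n\<^esub> h \<otimes>\<^bsub>SL n\<^esub> inv\<^bsub>SL n\<^esub> x \<in> SL_centre n"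
    if x: "x \<in> carrier (SL n)" and h: "h \<in> SL_centre n" for x h
  proof -
    have "x \<otimes>\<^bsub>SL n\<^esub> h = h \<otimes>\<^bsub>SL n\<^esub> x"
      using x h by (auto simp: SL_centre_def SL_def scal)
    then have "x \<otimes>\<^bsub>SL n\<^esub> h \<otimes>\<^bsub>SL n\<^esub> inv\<^bsub>SL n\<^esub> x = h"
      using x h sub by (auto simp: m_assoc)
    with h show ?thesis by simp
  qed
  ultimately show ?thesis by (auto simp: normal_inv_iff)
qed

lemma PSL_group: "group (PSL n)"
  unfolding PSL_def by (rule normal.factorgroup_is_group[OF SL_centre_normal])

definition torus :: "nat \<Rightarrow> complex mat set set" where
  "torus n = proj n ` {A \<in> carrier (SL n). diagonal_mat A}"

definition borel :: "nat \<Rightarrow> complex mat set set" where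
  "borel n = proj n ` {A \<in> carrier (SL n). upper_triangular A}"

text \<open>The stabiliser of the span of the first \<open>r\<close> standard basis vectors.\<close>

definition parabolic :: "nat \<Rightarrow> nat \<Rightarrow> complex mat set set" where
  "parabolic n r =
     proj n ` {A \<in> carrier (SL n). \<forall>i j. r \<le> i \<and> i < n \<and> j < r \<longrightarrow> A $$ (i, j) = 0}"

text \<open>
  The coset of \<open>T\<close> in its normaliser that corresponds to \<open>w\<close>: monomial matrices sending the
  \<open>j\<close>-th coordinate line to the \<open>w j\<close>-th one.
\<close>

definition weyl_coset :: "nat \<Rightarrow> (nat \<Rightarrow> nat) \<Rightarrow> complex mat set set" where
  "weyl_coset n w = proj n ` {A \<in> carrier (SL n).
     \<forall>i \<in> {1..n}. \<forall>j \<in> {1..n}. A $$ (i - 1, j - 1) \<noteq> 0 \<longleftrightarrow> i = w j}"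

definition simple_root :: "nat \<Rightarrow> complex mat set \<Rightarrow> complex" where
  "simple_root i g = the_elem ((\<lambda>A. A $$ (i - 1, i - 1) / A $$ (i, i)) ` g)"

text \<open>
  \<open>\<lambda>\<^sub>j(t)\<close> is the image of \<open>diag(t,\<dots>,t,1,\<dots>,1)\<close> (\<open>j\<close> entries \<open>t\<close>) under
  \<open>GL\<^sub>n \<rightarrow> PGL\<^sub>n = PSL\<^sub>n\<close>, i.e. the set of its scalar multiples of determinant \<open>1\<close>.
\<close>

definition cochar :: "nat \<Rightarrow> nat \<Rightarrow> complex \<Rightarrow> complex mat set" where
  "cochar n j t =
     {A \<in> carrier (SL n). \<exists>c. A = c \<cdot>\<^sub>m mat_diag n (\<lambda>i. if i < j then t else 1)}"

lemma simple_root_cochar: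
  assumes i: "i \<in> {1..n-1}" and j: "j \<in> {1..n-1}" and t: "t \<noteq> 0"
  shows "cochar n j t \<in> torus n"
    and "simple_root i (cochar n j t) = (if i = j then t else 1)"
proof -
  define D where "D = mat_diag n (\<lambda>i. if i < j then t else 1)"
  have D: "D \<in> carrier_mat n n" by (simp add: D_def)
  have dim [simp]: "dim_row D = n" "dim_col D = n" using D by auto
  have entry: "D $$ (a, b) = (if a = b then if a < j then t else 1 else 0)"
    if "a < n" "b < n" for a b
    using that by (auto simp: D_def mat_diag_def)
  have cochar: "cochar n j t = {A \<in> carrier (SL n). \<exists>c. A = c \<cdot>\<^sub>m D}"
    by (simp add: cochar_def D_def)
  have "det D = prod_list (diag_mat D)"
    by (rule det_upper_triangular[OF _ D]) (auto simp: upper_triangular_def entry)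
  also have "\<dots> = (\<Prod>i = 0..<n. if i < j then t else 1)"
    by (auto simp: prod_list_diag_prod entry intro!: prod.cong)
  finally have d0: "det D \<noteq> 0" using t by auto
  have scal: "(x \<cdot>\<^sub>m 1\<^sub>m n) * (y \<cdot>\<^sub>m D) = (x * y) \<cdot>\<^sub>m D" for x y :: complex
  proof -
    have "(x \<cdot>\<^sub>m 1\<^sub>m n) * (y \<cdot>\<^sub>m D) = x \<cdot>\<^sub>m (y \<cdot>\<^sub>m D)"
      using D by (subst mult_smult_assoc_mat[of _ n n _ n]) auto
    then show ?thesis by auto
  qed
  have n: "n > 0" using i by auto
  have "card {z. z ^ n = inverse (det D)} = n"
    by (rule card_nth_roots) (use d0 n in auto)
  with n have "{z. z ^ n = inverse (det D)} \<noteq> {}" by (metis card.empty less_irrefl)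
  then obtain c where c: "c ^ n = inverse (det D)" by blast
  with d0 n have c0: "c \<noteq> 0" by (auto simp: power_0_left)
  let ?A = "c \<cdot>\<^sub>m D"
  have A: "?A \<in> carrier (SL n)" using c d0 D by (auto simp: SL_def)
  have "cochar n j t = proj n ?A"
  proof (intro subset_antisym subsetI)
    fix B assume "B \<in> cochar n j t"
    then obtain b where B: "B = b \<cdot>\<^sub>m D" "det B = 1"
      by (auto simp: cochar SL_def)
    then have "b ^ n * det D = 1" using D by simp
    then have "b ^ n = c ^ n" using c d0 by (metis inverse_unique mult.commute)
    then have "(b / c) ^ n = 1" using c0 by (simp add: power_divide)
    moreover have "B = ((b / c) \<cdot>\<^sub>m 1\<^sub>m n) * ?A"
      using B c0 by (simp add: scal)
    ultimately show "B \<in> proj n ?A"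
      by (auto simp: proj_def r_coset_def SL_centre_def SL_def)
  next
    fix B assume "B \<in> proj n ?A"
    then obtain z where z: "z ^ n = 1" "B = (z \<cdot>\<^sub>m 1\<^sub>m n) * ?A"
      by (auto simp: proj_def r_coset_def SL_centre_def SL_def)
    then have "B = (z * c) \<cdot>\<^sub>m D"
      by (simp add: scal)
    moreover from this have "det B = 1"
      using z c d0 D by (simp add: power_mult_distrib)
    ultimately show "B \<in> cochar n j t" using D by (auto simp: cochar SL_def)
  qed
  then show "cochar n j t \<in> torus n"
    using A by (auto simp: torus_def diagonal_mat_def entry intro!: imageI)
  have "B $$ (i - 1, i - 1) / B $$ (i, i) = (if i = j then t else 1)"
    if "B \<in> cochar n j t" for B
  proof -
    from that obtain b where B: "B = b \<cdot>\<^sub>m D" "det B = 1"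
      by (auto simp: cochar SL_def)
    with D n have "b \<noteq> 0" by (auto simp: power_0_left)
    with B i j t show ?thesis by (auto simp: entry split: if_splits)
  qed
  moreover have "?A \<in> cochar n j t" using A by (auto simp: cochar)
  ultimately have "(\<lambda>A. A $$ (i - 1, i - 1) / A $$ (i, i)) ` cochar n j t
      = {if i = j then t else 1}" by (auto simp: image_iff) 
  then show "simple_root i (cochar n j t) = (if i = j then t else 1)"
    unfolding simple_root_def by simp
qed

text \<open>
  The images of the one-parameter subgroups are closed, connected and commute, so the abstract
  subgroup they generate is already the subtorus they generate.
\<close>

definition subtorus :: "nat \<Rightarrow> nat set \<Rightarrow> complex mat set set" where
  "subtorus n J = generate (PSL n) (\<Union>j \<in> J. cochar n j ` (UNIV - {0}))"


section \<open>Zariski topology, Schubert varieties\<close>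

text \<open>Polynomial functions in the entries of an \<open>n \<times> n\<close> matrix.\<close>

inductive_set mat_polys :: "nat \<Rightarrow> (complex mat \<Rightarrow> complex) set" for n where
  const: "(\<lambda>A. c) \<in> mat_polys n"
| entry: "i < n \<Longrightarrow> j < n \<Longrightarrow> (\<lambda>A. A $$ (i, j)) \<in> mat_polys n"
| add: "p \<in> mat_polys n \<Longrightarrow> q \<in> mat_polys n \<Longrightarrow> (\<lambda>A. p A + q A) \<in> mat_polys n"
| mult: "p \<in> mat_polys n \<Longrightarrow> q \<in> mat_polys n \<Longrightarrow> (\<lambda>A. p A * q A) \<in> mat_polys n"

text \<open>
  The coordinate ring of \<open>PSL\<^sub>n\<close> consists of the regular functions on the closed subvariety
  \<open>SL\<^sub>n\<close> of matrix space that are constant on the cosets of the centre.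
\<close>

definition regular_fun :: "nat \<Rightarrow> (complex mat set \<Rightarrow> complex) \<Rightarrow> bool" where
  "regular_fun n \<phi> \<longleftrightarrow> (\<exists>p \<in> mat_polys n. \<forall>A \<in> carrier (SL n). \<phi> (proj n A) = p A)"

definition zariski_closed :: "nat \<Rightarrow> complex mat set set \<Rightarrow> bool" where
  "zariski_closed n Z \<longleftrightarrow>
     (\<exists>F. (\<forall>\<phi> \<in> F. regular_fun n \<phi>) \<and> Z = {g \<in> carrier (PSL n). \<forall>\<phi> \<in> F. \<phi> g = 0})"

text \<open>The homogeneous space \<open>G/P\<close> as the set of left cosets, with the quotient topology.\<close>

definition flag_point :: "nat \<Rightarrow> nat \<Rightarrow> complex mat set \<Rightarrow> complex mat set set" where
  "flag_point n r g = g <#\<^bsub>PSL n\<^esub> parabolic n r"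

definition flag_variety :: "nat \<Rightarrow> nat \<Rightarrow> complex mat set set set" where
  "flag_variety n r = flag_point n r ` carrier (PSL n)"

definition flag_closed :: "nat \<Rightarrow> nat \<Rightarrow> complex mat set set set \<Rightarrow> bool" where
  "flag_closed n r Z \<longleftrightarrow> Z \<subseteq> flag_variety n r \<and>
     zariski_closed n {g \<in> carrier (PSL n). flag_point n r g \<in> Z}"

definition schubert_cell :: "nat \<Rightarrow> nat \<Rightarrow> (nat \<Rightarrow> nat) \<Rightarrow> complex mat set set set" where
  "schubert_cell n r w = flag_point n r ` (borel n <#>\<^bsub>PSL n\<^esub> weyl_coset n w)"

definition schubert_variety :: "nat \<Rightarrow> nat \<Rightarrow> (nat \<Rightarrow> nat) \<Rightarrow> complex mat set set set" where
  "schubert_variety n r w = \<Inter> {Z. flag_closed n r Z \<and> schubert_cell n r w \<subseteq> Z}"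

definition schubert_preimage :: "nat \<Rightarrow> nat \<Rightarrow> (nat \<Rightarrow> nat) \<Rightarrow> complex mat set set" where
  "schubert_preimage n r w = {g \<in> carrier (PSL n). flag_point n r g \<in> schubert_variety n r w}"


section \<open>The line bundle $\mathcal{L}(n\omega_r)$ and semistability\<close>

text \<open>
  The character \<open>n\<omega>\<^sub>r\<close> of \<open>T\<close>, in its unique extension to \<open>P\<close>: on a diagonal matrix
  \<open>\<omega>\<^sub>r\<close> is the product of the first \<open>r\<close> entries, on \<open>P\<close> it is the determinant of the upper left
  \<open>r \<times> r\<close> block.  The \<open>n\<close>-th power does not depend on the lift to \<open>SL\<^sub>n\<close>.
\<close>

definition n_omega :: "nat \<Rightarrow> nat \<Rightarrow> complex mat set \<Rightarrow> complex" where
  "n_omega n r g = the_elem ((\<lambda>A. det (mat r r (\<lambda>(i, j). A $$ (i, j))) ^ n) ` g)"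

lemma n_omega_proj:
  assumes A: "A \<in> carrier (SL n)" and r: "r \<le> n"
  shows "n_omega n r (proj n A) = det (mat r r (\<lambda>(i, j). A $$ (i, j))) ^ n"
proof -
  let ?d = "\<lambda>A :: complex mat. det (mat r r (\<lambda>(i, j). A $$ (i, j))) ^ n"
  from A have Ac: "A \<in> carrier_mat n n" by (simp add: SL_def)
  have "?d B = ?d A" if B: "B \<in> proj n A" for B
  proof -
    from B obtain z where z: "z ^ n = 1" "B = (z \<cdot>\<^sub>m 1\<^sub>m n) * A"
      by (auto simp: proj_def r_coset_def SL_centre_def SL_def)
    then have "B = z \<cdot>\<^sub>m A"
      using Ac by (simp add: mult_smult_assoc_mat[of _ n n _ n])
    then have "mat r r (\<lambda>(i, j). B $$ (i, j)) = z \<cdot>\<^sub>m mat r r (\<lambda>(i, j). A $$ (i, j))"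
      using Ac r by (intro eq_matI) auto
    then have "?d B = (z ^ n) ^ r * ?d A"
      by (simp add: power_mult_distrib flip: power_mult) (simp add: mult.commute)
    with z show ?thesis by simp
  qed
  moreover have "A \<in> proj n A"
    unfolding proj_def
    using group.rcos_self[OF SL_group A] SL_centre_normal normal_imp_subgroup by blast
  ultimately have "?d ` proj n A = {?d A}" by blast
  then show ?thesis by (simp add: n_omega_def)
qed

text \<open>
  Sections over \<open>X(w)\<close> of the \<open>k\<close>-th power of the line bundle associated with \<open>n\<omega>\<^sub>r\<close>: regular
  functions on the preimage of \<open>X(w)\<close> in the affine variety \<open>G\<close> (a closed subvariety, so that they
  are restrictions of regular functions on \<open>G\<close>) which transform under \<open>P\<close> by the character.  The
  sign is the one that makes the bundle \<open>\<O>(n)\<close> in the Pluecker embedding: the minors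
  on the first \<open>r\<close> columns satisfy \<open>f(gp) = \<omega>\<^sub>r(p) f(g)\<close>.
  Only the values of \<open>f\<close> on the preimage are relevant.
\<close>

definition bundle_section ::
  "nat \<Rightarrow> nat \<Rightarrow> (nat \<Rightarrow> nat) \<Rightarrow> nat \<Rightarrow> (complex mat set \<Rightarrow> complex) \<Rightarrow> bool" where
  "bundle_section n r w k f \<longleftrightarrow>
     (\<exists>\<phi>. regular_fun n \<phi> \<and> (\<forall>g \<in> schubert_preimage n r w. f g = \<phi> g)) \<and>
     (\<forall>g \<in> schubert_preimage n r w. \<forall>p \<in> parabolic n r.
        f (g \<otimes>\<^bsub>PSL n\<^esub> p) = n_omega n r p ^ k * f g)"

text \<open>\<open>G\<close> acts on sections by left translation.\<close>

definition invariant_section ::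
  "nat \<Rightarrow> nat \<Rightarrow> (nat \<Rightarrow> nat) \<Rightarrow> complex mat set set \<Rightarrow> (complex mat set \<Rightarrow> complex) \<Rightarrow> bool" where
  "invariant_section n r w H f \<longleftrightarrow>
     (\<forall>h \<in> H. \<forall>g \<in> schubert_preimage n r w. f (inv\<^bsub>PSL n\<^esub> h \<otimes>\<^bsub>PSL n\<^esub> g) = f g)"

text \<open>A section vanishes at the point \<open>x = gP\<close> iff it vanishes at one, equivalently at every, \<open>g \<in> x\<close>.\<close>

definition semistable ::
  "nat \<Rightarrow> nat \<Rightarrow> (nat \<Rightarrow> nat) \<Rightarrow> complex mat set set \<Rightarrow> complex mat set set set" where
  "semistable n r w H = {x \<in> schubert_variety n r w.
     \<exists>k > 0. \<exists>f. bundle_section n r w k f \<and> invariant_section n r w H f \<and> (\<exists>g \<in> x. f g \<noteq> 0)}"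

end

theory Submission
  imports Defs "HOL-Library.Nat_Bijection"
begin

text \<open>
  A minimal coset representative \<open>v\<close> is determined by the set \<open>V = v ` {1..r}\<close>, and the Bruhat order
  on these representatives compares the counting functions \<open>rank_upto V j = |V \<inter> {1..j}|\<close>: \<open>u \<le> v\<close> as
  soon as \<open>|V \<inter> {1..j}| \<le> |U \<inter> {1..j}|\<close> for all \<open>j\<close> (\<open>grassmannian_bruhat_le\<close>).  Everything is reduced to
  these counting functions.

  \<^emph>\<open>A necessary condition\<close> (\<open>semistable_rank_bound\<close>).  If the torus contains \<open>\<lambda>\<^sub>j\<close>, an invariant section of
  the \<open>k\<close>-th power of the bundle that does not vanish on \<open>X(v)\<close> does not vanish at some \<open>b n\<^sub>v\<close> with
  \<open>b \<in> B\<close>, because its zeros form a closed set.  Moving this point by \<open>\<lambda>\<^sub>j(t)\<close> and letting \<open>t\<close> tend to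
  infinity keeps \<open>b\<close> within a bounded part of \<open>B\<close>, whereas the value of the section is multiplied by
  \<open>t\<close> to the power \<open>k(n |V \<inter> {1..j}| - r j)\<close>.  Hence \<open>n |V \<inter> {1..j}| \<le> r j\<close>, that is
  \<open>|V \<inter> {1..j}| \<le> \<lfloor>r j / n\<rfloor>\<close>.

  \<^emph>\<open>The condition is attained for the full torus\<close> (\<open>semistable_balanced\<close>).  Cut \<open>0, 1, \<dots>, r n - 1\<close> into \<open>r\<close>
  blocks of length \<open>n\<close>, take the \<open>m\<close>-th member of every block and divide by \<open>r\<close>, rounding down.  This gives
  \<open>r\<close>-subsets \<open>I\<^sub>0, \<dots>, I\<^sub>n\<^sub>-\<^sub>1\<close> of \<open>{0..<n}\<close> which together contain each index exactly \<open>r\<close> times, so the product of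
  the corresponding \<open>n\<close> Pluecker coordinates is a \<open>T\<close>-invariant section of the bundle itself.
  Componentwise all \<open>I\<^sub>m\<close> lie below \<open>I\<^sub>n\<^sub>-\<^sub>1\<close>, hence the product does not vanish identically on the Schubert
  variety \<open>X(u)\<close> that belongs to \<open>I\<^sub>n\<^sub>-\<^sub>1\<close>.  For this \<open>u\<close> the count up to \<open>j\<close> is exactly \<open>\<lfloor>r j / n\<rfloor>\<close>
  (\<open>rank_upto_balanced\<close>).  So \<open>u\<close> lies below every representative with \<open>T\<close>-semistable points, and the minimal
  \<open>w\<close> is equal to \<open>u\<close>.

  \<^emph>\<open>Peaks suffice\<close> (\<open>rank_upto_le_if_peaks\<close>).  If \<open>X(v)\<close> has semistable points for the subtorus of the peaks of
  \<open>w\<close>, then the count of \<open>v\<close> is at most that of \<open>w\<close> at every peak.  A peak is a place where the set of \<open>w\<close>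
  switches from a run of absent to a run of present numbers.  Along a present run the count of \<open>w\<close> grows
  as fast as possible, along an absent run it stays constant up to the next peak, so the inequality at the
  peaks spreads to all \<open>j\<close> and gives \<open>w \<le> v\<close>.  As the subtorus is contained in \<open>T\<close>, \<open>w\<close> itself
  has semistable points for it.
\<close>

section \<open>Length and inversions\<close>

definition inversions :: "nat \<Rightarrow> (nat \<Rightarrow> nat) \<Rightarrow> (nat \<times> nat) set" where
  "inversions n p = {(i, k). i \<in> {1..n} \<and> k \<in> {1..n} \<and> i < k \<and> p k < p i}"

lemma finite_inversions [simp]: "finite (inversions n p)"
  by (rule finite_subset[of _ "{1..n} \<times> {1..n}"]) (auto simp: inversions_def)

lemma permutes_mem: "p permutes A \<Longrightarrow> x \<in> A \<Longrightarrow> p x \<in> A"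
  by (simp add: permutes_in_image)

lemma inversions_id [simp]: "inversions n id = {}"
  by (auto simp: inversions_def)

lemma simple_refl_permutes: "a \<in> {1..n-1} \<Longrightarrow> simple_refl a permutes {1..n}"
  unfolding simple_refl_def by (rule permutes_swap_id) auto

lemma simple_refl_idem [simp]: "simple_refl a \<circ> (simple_refl a \<circ> p) = p"
  by (auto simp: simple_refl_def fun_eq_iff)

text \<open>
  A simple reflection moves only two neighbouring values, so it disturbs no comparison except the
  one between them.  Multiplication by it on the left therefore changes a single inversion.
\<close>

lemma simple_refl_less_iff:
  assumes "x \<noteq> y" "{x, y} \<noteq> {a, a + 1}"
  shows "simple_refl a x < simple_refl a y \<longleftrightarrow> x < y"
  using assms by (auto simp: simple_refl_def Transposition.transpose_def)

lemma card_inversions_ascent: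
  assumes p: "p permutes {1..n}" and x: "x \<in> {1..n}" "p x = a"
    and y: "y \<in> {1..n}" "p y = a + 1" and xy: "x < y"
  shows "card (inversions n (simple_refl a \<circ> p)) = Suc (card (inversions n p))"
proof -
  have inj: "p i = p k \<longleftrightarrow> i = k" for i k
    using permutes_inj[OF p] by (auto simp: inj_def)
  have px: "p i = a \<longleftrightarrow> i = x" for i
    using inj[of i x] x by simp
  have py: "p i = a + 1 \<longleftrightarrow> i = y" for i
    using inj[of i y] y by simp
  have "(i, k) \<in> inversions n (simple_refl a \<circ> p) \<longleftrightarrow> (i, k) \<in> insert (x, y) (inversions n p)" for i k
  proof (cases "{p i, p k} = {a, a + 1}")
    case True
    then have "i = x \<and> k = y \<or> i = y \<and> k = x"
      using px py by (auto simp: doubleton_eq_iff)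
    then show ?thesis
      using x y xy by (auto simp: inversions_def simple_refl_def)
  next
    case False
    then have *: "{p k, p i} \<noteq> {a, a + 1}" by (simp add: insert_commute)
    from False have "(i, k) \<noteq> (x, y)" using x y by auto
    then show ?thesis
      using simple_refl_less_iff[OF _ *] inj by (auto simp: inversions_def)
  qed
  then have "inversions n (simple_refl a \<circ> p) = insert (x, y) (inversions n p)"
    by (auto simp del: insert_iff)
  moreover have "(x, y) \<notin> inversions n p"
    using x y by (auto simp: inversions_def)
  ultimately show ?thesis by simp
qed

lemma card_inversions_descent:
  assumes p: "p permutes {1..n}" and x: "x \<in> {1..n}" "p x = a + 1"
    and y: "y \<in> {1..n}" "p y = a" and xy: "x < y"
  shows "card (inversions n p) = Suc (card (inversions n (simple_refl a \<circ> p)))"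
proof -
  have "p x \<in> {1..n}" "p y \<in> {1..n}"
    using permutes_mem[OF p] x(1) y(1) by blast+
  then have a: "a \<in> {1..n-1}" using x y by auto
  have "simple_refl a \<circ> p permutes {1..n}"
    by (rule permutes_compose[OF p simple_refl_permutes[OF a]])
  from card_inversions_ascent[OF this x(1) _ y(1) _ xy, of a] x y show ?thesis
    by (simp add: simple_refl_def[of a, THEN fun_cong])
qed

lemma card_inversions_le:
  assumes p: "p permutes {1..n}" and a: "a \<in> {1..n-1}"
  shows "card (inversions n (simple_refl a \<circ> p)) \<le> Suc (card (inversions n p))"
proof -
  define x y where "x = inv' p a" and "y = inv' p (a + 1)"
  have xy: "x \<in> {1..n}" "y \<in> {1..n}"
    unfolding x_def y_def by (rule permutes_mem[OF permutes_inv[OF p]], use a in force)+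
  moreover have xy': "p x = a" "p y = a + 1"
    by (simp_all add: x_def y_def permutes_inverses[OF p])
  ultimately have "x \<noteq> y" by auto
  then show ?thesis
    using card_inversions_ascent[OF p xy(1) xy'(1) xy(2) xy'(2)]
      card_inversions_descent[OF p xy(2) xy'(2) xy(1) xy'(1)]
    by (cases "x < y") auto
qed

text \<open>
  The value at \<open>x\<close> is the element of the common image that has as many elements below
  it as \<open>x\<close> has below it in \<open>A\<close>.
\<close>

lemma strict_mono_on_eqI:
  fixes f g :: "'a :: linorder \<Rightarrow> 'b :: linorder"
  assumes A: "finite A" and f: "strict_mono_on A f" and g: "strict_mono_on A g"
    and im: "f ` A = g ` A" and x: "x \<in> A"
  shows "f x = g x"
proof -
  have rank: "card {z \<in> h ` A. z < h x} = card {a \<in> A. a < x}" if h: "strict_mono_on A h"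
    for h :: "'a \<Rightarrow> 'b"
  proof -
    have "{z \<in> h ` A. z < h x} = h ` {a \<in> A. a < x}"
      using h x by (auto simp: strict_mono_on_less)
    moreover have "inj_on h {a \<in> A. a < x}"
      by (rule inj_on_subset[OF strict_mono_on_imp_inj_on[OF h]]) auto
    ultimately show ?thesis by (simp add: card_image)
  qed
  have less: "card {z \<in> f ` A. z < b} < card {z \<in> f ` A. z < c}" if "b < c" "b \<in> f ` A" for b c
    using that A by (intro psubset_card_mono) (auto dest: less_trans)
  have "g x \<in> f ` A" using x im by auto
  with less[of "f x" "g x"] less[of "g x" "f x"] rank[OF f] rank[OF g] x im show ?thesis
    by (cases "f x" "g x" rule: linorder_cases) auto
qed

lemma strict_mono_on_SucI:
  fixes f :: "nat \<Rightarrow> 'a :: order"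
  assumes "\<And>i. a \<le> i \<Longrightarrow> i < b \<Longrightarrow> f i < f (Suc i)"
  shows "strict_mono_on {a..b} f"
proof (rule strict_mono_onI)
  fix x y assume "x \<in> {a..b}" "y \<in> {a..b}" "x < y"
  from \<open>x < y\<close> \<open>y \<in> {a..b}\<close> show "f x < f y"
  proof (induction y)
    case (Suc y)
    show ?case
    proof (cases "x = y")
      case False
      with Suc \<open>x \<in> {a..b}\<close> have "f x < f y" by auto
      also have "f y < f (Suc y)" using Suc \<open>x \<in> {a..b}\<close> by (intro assms) auto
      finally show ?thesis .
    qed (use assms \<open>x \<in> {a..b}\<close> Suc in auto)
  qed simp
qed

lemma expression_card_inversions:
  assumes "expression n is p"
  shows "p permutes {1..n} \<and> card (inversions n p) \<le> length is"
  using assms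
proof (induction "is" arbitrary: p)
  case Nil
  then have "p = id" by (simp add: expression_def word_prod_def)
  then show ?case using permutes_id[of "{1..n}"] by (simp only: inversions_id) simp
next
  case (Cons a "is")
  let ?q = "word_prod is"
  have a: "a \<in> {1..n-1}" and p: "p = simple_refl a \<circ> ?q" and q: "expression n is ?q"
    using Cons.prems by (auto simp: expression_def word_prod_def)
  have IH: "?q permutes {1..n}" "card (inversions n ?q) \<le> length is"
    using Cons.IH[OF q] by auto
  have "card (inversions n (simple_refl a \<circ> ?q)) \<le> length (a # is)"
    using card_inversions_le[OF IH(1) a] IH(2) by simp
  with permutes_compose[OF IH(1) simple_refl_permutes[OF a]] show ?case
    unfolding p by blast
qed

text \<open>
  Otherwise the inverse is increasing on \<open>{1..n}\<close> and hence the identity.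
\<close>

lemma ex_left_descent:
  fixes n :: nat
  assumes p: "p permutes {1..n}" and "p \<noteq> id"
  shows "\<exists>a \<in> {1..n-1}. inv' p (a + 1) < inv' p a"
proof (rule ccontr)
  let ?q = "inv' p"
  assume *: "\<not> (\<exists>a \<in> {1..n-1}. ?q (a + 1) < ?q a)"
  have q: "?q permutes {1..n}" using p by (rule permutes_inv)
  have "?q a < ?q (Suc a)" if "1 \<le> a" "a < n" for a
  proof -
    have "?q a \<noteq> ?q (Suc a)" using inj_eq[OF permutes_inj[OF q], of a "Suc a"] by simp
    moreover have "?q a \<le> ?q (Suc a)" using * that by (auto simp: not_less)
    ultimately show ?thesis by simp
  qed
  then have "strict_mono_on {1..n} ?q" by (rule strict_mono_on_SucI)
  then have "?q a = id a" if "a \<in> {1..n}" for a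
    using permutes_image[OF q] that
    by (intro strict_mono_on_eqI[of "{1..n}"]) (auto simp: strict_mono_on_def)
  then have "?q = id" using q by (auto simp: fun_eq_iff permutes_def)
  then have "p = id" using permutes_inv_inv[OF p] by simp
  with \<open>p \<noteq> id\<close> show False by simp
qed

text \<open>
  Removing a left descent lowers the number of inversions by one; this sorts \<open>p\<close> in
  exactly that many steps.
\<close>

lemma expression_of_inversions:
  assumes "p permutes {1..n}"
  shows "\<exists>is. expression n is p \<and> length is = card (inversions n p)"
  using assms
proof (induction "card (inversions n p)" arbitrary: p rule: less_induct)
  case less
  note p = less.prems
  show ?case
  proof (cases "p = id")
    case True
    then show ?thesis
      by (intro exI[of _ "[]"]) (simp add: expression_def word_prod_def)
  next
    case False
    with ex_left_descent[OF p] obtain a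
      where a: "a \<in> {1..n-1}" "inv' p (a + 1) < inv' p a" by blast
    have "inv' p (a + 1) \<in> {1..n}" "inv' p a \<in> {1..n}"
      by (rule permutes_mem[OF permutes_inv[OF p]], use a(1) in force)+
    with a have c: "card (inversions n p) = Suc (card (inversions n (simple_refl a \<circ> p)))"
      by (intro card_inversions_descent[OF p]) (auto simp: permutes_inverses[OF p])
    have "simple_refl a \<circ> p permutes {1..n}"
      using a by (intro permutes_compose[OF p] simple_refl_permutes)
    from less.hyps[OF _ this] c obtain "is"
      where "is": "expression n is (simple_refl a \<circ> p)"
        "length is = card (inversions n (simple_refl a \<circ> p))" by auto
    then have "expression n (a # is) p"
      using a by (auto simp: expression_def word_prod_def)
    with "is" c show ?thesis by (intro exI[of _ "a # is"]) auto
  qed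
qed

lemma weyl_length_eq_card_inversions:
  assumes "p permutes {1..n}"
  shows "weyl_length n p = card (inversions n p)"
  unfolding weyl_length_def
  using expression_of_inversions[OF assms] expression_card_inversions[of n _ p]
  by (intro Least_equality) auto

text \<open>
  A reduced expression of \<open>s\<^sub>a p\<close> becomes a reduced expression of
  \<open>p\<close> when \<open>a\<close> is put in front.
\<close>

lemma peaksI:
  assumes p: "p permutes {1..n}" and x: "x \<in> {1..n}" "p x = a + 1"
    and y: "y \<in> {1..n}" "p y = a" and xy: "x < y"
  shows "a \<in> peaks n p"
proof -
  have "p x \<in> {1..n}" "p y \<in> {1..n}"
    using permutes_mem[OF p] x(1) y(1) by blast+
  then have a: "a \<in> {1..n-1}" using x y by auto
  have "simple_refl a \<circ> p permutes {1..n}"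
    by (rule permutes_compose[OF p simple_refl_permutes[OF a]])
  from expression_of_inversions[OF this] obtain "is"
    where "is": "expression n is (simple_refl a \<circ> p)"
      "length is = card (inversions n (simple_refl a \<circ> p))" by blast
  have "expression n (a # is) p"
    using a "is" by (auto simp: expression_def word_prod_def)
  then have "reduced_expression n (a # is) p"
    using "is" card_inversions_descent[OF p x y xy] weyl_length_eq_card_inversions[OF p]
    by (simp add: reduced_expression_def)
  then show ?thesis by (auto simp: peaks_def)
qed

lemma peaks_subset: "peaks n p \<subseteq> {1..n-1}"
  by (auto simp: peaks_def reduced_expression_def expression_def)

lemma bruhat_le_imp_eq_or_less:
  "bruhat_le n u v \<Longrightarrow> u = v \<or> weyl_length n u < weyl_length n v"
  unfolding bruhat_le_def
  by (induction rule: rtranclp_induct) (auto simp: bruhat_step_def)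

lemma bruhat_le_antisym: "bruhat_le n u v \<Longrightarrow> bruhat_le n v u \<Longrightarrow> u = v"
  using bruhat_le_imp_eq_or_less[of n u v] bruhat_le_imp_eq_or_less[of n v u] by auto

text \<open>
  Bruhat steps are defined by multiplication with reflections on the right; here the reflection is
  the conjugate of \<open>s\<^sub>a\<close> by \<open>p\<close>.
\<close>

lemma bruhat_step_left:
  assumes p: "p permutes {1..n}" and x: "x \<in> {1..n}" "p x = a"
    and y: "y \<in> {1..n}" "p y = a + 1" and xy: "x < y"
  shows "bruhat_step n p (simple_refl a \<circ> p)"
proof -
  have "p x \<in> {1..n}" "p y \<in> {1..n}"
    using permutes_mem[OF p] x(1) y(1) by blast+
  then have a: "a \<in> {1..n-1}" using x y by auto
  \<comment> \<open>The second inverse is \<open>p\<close> itself; the shape is that of the definition of reflections.\<close>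
  define t where "t = inv' p \<circ> simple_refl a \<circ> inv' (inv' p)"
  have "t \<in> reflections n"
    unfolding reflections_def t_def using a permutes_inv[OF p]
    by (auto simp: sym_group_carrier)
  moreover have "simple_refl a \<circ> p = p \<circ> t"
    by (simp add: t_def permutes_inv_inv[OF p] fun_eq_iff permutes_inverses[OF p])
  ultimately show ?thesis
    using card_inversions_ascent[OF assms] weyl_length_eq_card_inversions[OF p]
      weyl_length_eq_card_inversions[OF permutes_compose[OF p simple_refl_permutes[OF a]]]
    by (auto simp: bruhat_step_def)
qed

section \<open>Minimal coset representatives and the Bruhat order\<close>

definition rank_upto :: "nat set \<Rightarrow> nat \<Rightarrow> nat" where
  "rank_upto U j = card {x \<in> U. x \<le> j}"

text \<open>
  The permutations that increase on both blocks are the combinatorial form of the minimal coset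
  representatives.  Unlike the definition by minimal length, this form can be followed under left
  multiplication by a simple reflection.
\<close>

definition grassmannian :: "nat \<Rightarrow> nat \<Rightarrow> (nat \<Rightarrow> nat) \<Rightarrow> bool" where
  "grassmannian n r u \<longleftrightarrow>
     u permutes {1..n} \<and> strict_mono_on {1..r} u \<and> strict_mono_on {Suc r..n} u"

lemma card_inversions_inv:
  assumes p: "p permutes {1..n}"
  shows "card (inversions n (inv' p)) = card (inversions n p)"
proof -
  have "bij_betw (\<lambda>(i, k). (p k, p i)) (inversions n p) (inversions n (inv' p))"
    by (rule bij_betw_byWitness[where f' = "\<lambda>(i, k). (inv' p k, inv' p i)"])
      (use permutes_mem[OF p] permutes_mem[OF permutes_inv[OF p]] in
        \<open>auto simp: inversions_def permutes_inverses[OF p] simp del: atLeastAtMost_iff\<close>)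
  then show ?thesis by (simp add: bij_betw_same_card)
qed

lemma simple_refl_in_parabolic_weyl:
  assumes "i \<in> {1..n-1}" "i \<noteq> r"
  shows "simple_refl i \<in> parabolic_weyl n r"
  unfolding parabolic_weyl_def using assms by (intro generate.incl) auto

text \<open>
  A descent inside a block could be removed by a simple reflection of the parabolic subgroup.
  That is a multiplication on the right, which the passage to inverses turns into one on the left.
\<close>

lemma min_reps_grassmannian:
  assumes v: "v \<in> min_reps n r" and r: "r \<le> n"
  shows "grassmannian n r v"
proof -
  have p: "v permutes {1..n}" using v by (simp add: min_reps_def sym_group_carrier)
  have asc: "v i < v (Suc i)" if i: "i \<in> {1..n-1}" "i \<noteq> r" for i
  proof (rule ccontr)
    assume "\<not> v i < v (Suc i)"
    moreover have "v i \<noteq> v (Suc i)" using inj_eq[OF permutes_inj[OF p], of i "Suc i"] by simp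
    ultimately have less: "v (Suc i) < v i" by simp
    have mem: "v (Suc i) \<in> {1..n}" "v i \<in> {1..n}"
      by (rule permutes_mem[OF p], use i in force)+
    have s: "simple_refl i permutes {1..n}" by (rule simple_refl_permutes[OF i(1)])
    have "inv' (simple_refl i) = simple_refl i"
      by (simp add: simple_refl_def)
    then have "inv' (v \<circ> simple_refl i) = simple_refl i \<circ> inv' v"
      using o_inv_distrib[OF permutes_bij[OF p] permutes_bij[OF s]] by simp
    then have "card (inversions n (v \<circ> simple_refl i))
        = card (inversions n (simple_refl i \<circ> inv' v))"
      using card_inversions_inv[OF permutes_compose[OF s p]] by simp
    moreover have "card (inversions n v) = Suc (card (inversions n (simple_refl i \<circ> inv' v)))"
      using card_inversions_descent[OF permutes_inv[OF p] mem(1) _ mem(2) _ less, of i]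
        card_inversions_inv[OF p] by (simp add: permutes_inverses[OF p])
    moreover have "weyl_length n v \<le> weyl_length n (v \<circ> simple_refl i)"
      using v simple_refl_in_parabolic_weyl[OF i] by (simp add: min_reps_def)
    ultimately show False
      using weyl_length_eq_card_inversions[OF p]
        weyl_length_eq_card_inversions[OF permutes_compose[OF s p]] by simp
  qed
  have "strict_mono_on {1..r} v" "strict_mono_on {Suc r..n} v"
    by (rule strict_mono_on_SucI, rule asc, use r in auto)+
  with p show ?thesis by (simp add: grassmannian_def)
qed

lemma parabolic_weyl_stabilises:
  assumes "v \<in> parabolic_weyl n r" "r \<le> n"
  shows "v permutes {1..n} \<and> v ` {1..r} = {1..r}"
proof -
  have s: "simple_refl i permutes {1..n}" "simple_refl i ` {1..r} = {1..r}"
    if "i \<in> {1..n-1} - {r}" for i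
  proof -
    show "simple_refl i permutes {1..n}" using that by (intro simple_refl_permutes) auto
    show "simple_refl i ` {1..r} = {1..r}"
    proof (cases "i < r")
      case True
      with that show ?thesis
        by (intro permutes_image) (auto simp: simple_refl_def intro!: permutes_swap_id)
    next
      case False
      with that have "simple_refl i x = x" if "x \<in> {1..r}" for x
        using \<open>x \<in> {1..r}\<close> by (auto simp: simple_refl_def Transposition.transpose_def)
      then show ?thesis by auto
    qed
  qed
  have i: "inv\<^bsub>sym_group n\<^esub> (simple_refl i) = simple_refl i" if "i \<in> {1..n-1}" for i
    using sym_group_inv_equality[of "simple_refl i" n] simple_refl_permutes[OF that]
    by (simp add: sym_group_carrier simple_refl_def)
  show ?thesis
    using assms(1) unfolding parabolic_weyl_def
  proof (induction rule: generate.induct)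
    case one
    show ?case using permutes_id by (simp add: sym_group_one permutes_id[unfolded id_def])
  next
    case (incl h)
    then show ?case using s by blast
  next
    case (inv h)
    then obtain j where "h = simple_refl j" "j \<in> {1..n-1} - {r}" by blast
    then show ?case using s[of j] i[of j] by simp
  next
    case (eng g h)
    then have "g \<circ> h permutes {1..n}" "(g \<circ> h) ` {1..r} = {1..r}"
      by (blast intro: permutes_compose, simp only: image_comp[symmetric])
    then show ?case unfolding sym_group_mult by blast
  qed
qed

text \<open>
  Any permutation with the prescribed image, multiplied by an element of the parabolic subgroup
  for which the product has least length.
\<close>

lemma ex_min_rep:
  assumes U: "U \<subseteq> {1..n}" "card U = r"
  obtains u where "u \<in> min_reps n r" "u ` {1..r} = U"
proof -
  have fin: "finite U" using U finite_subset by blast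
  have r: "r \<le> n" using card_mono[OF _ U(1)] U(2) by simp
  obtain f where f: "bij_betw f {1..r} U"
    using finite_same_card_bij[OF _ fin, of "{1..r}"] U by auto
  have "card {Suc r..n} = card ({1..n} - U)"
    using U fin by (simp add: card_Diff_subset)
  then obtain g where g: "bij_betw g {Suc r..n} ({1..n} - U)"
    using finite_same_card_bij[of "{Suc r..n}" "{1..n} - U"] by auto
  define p where "p i = (if i \<in> {1..n} then if i \<le> r then f i else g i else i)" for i
  have "bij_betw p {1..r} U"
    using f r by (subst bij_betw_cong[of _ _ f]) (auto simp: p_def)
  moreover have "bij_betw p {Suc r..n} ({1..n} - U)"
    using g by (subst bij_betw_cong[of _ _ g]) (auto simp: p_def)
  ultimately have "bij_betw p ({1..r} \<union> {Suc r..n}) (U \<union> ({1..n} - U))"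
    by (rule bij_betw_combine) auto
  moreover have "{1..r} \<union> {Suc r..n} = {1..n}" "U \<union> ({1..n} - U) = {1..n}"
    using r U by auto
  ultimately have "bij_betw p {1..n} {1..n}" by simp
  then have p: "p permutes {1..n}" by (rule bij_imp_permutes) (auto simp: p_def)
  have pU: "p ` {1..r} = U" using \<open>bij_betw p {1..r} U\<close> by (simp add: bij_betw_def)
  let ?W = "parabolic_weyl n r"
  have "id \<in> ?W"
    unfolding parabolic_weyl_def using generate.one[of "sym_group n"] by (simp add: sym_group_one)
  then obtain v where v: "v \<in> ?W"
    "\<And>v'. v' \<in> ?W \<Longrightarrow> weyl_length n (p \<circ> v) \<le> weyl_length n (p \<circ> v')"
    using ex_has_least_nat[of "\<lambda>v. v \<in> ?W" id "\<lambda>v. weyl_length n (p \<circ> v)"] by blast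
  have "v permutes {1..n}" "v ` {1..r} = {1..r}"
    using parabolic_weyl_stabilises[OF v(1) r] by auto
  moreover have "v \<circ> v' \<in> ?W" if "v' \<in> ?W" for v'
    using v(1) that generate.eng[of v "sym_group n" _ v']
    by (simp add: parabolic_weyl_def sym_group_mult)
  ultimately have "p \<circ> v \<in> min_reps n r"
    using v(2) permutes_compose[OF _ p]
    by (auto simp: min_reps_def sym_group_carrier comp_assoc)
  moreover have "(p \<circ> v) ` {1..r} = U"
    using pU \<open>v ` {1..r} = {1..r}\<close> by (simp only: image_comp[symmetric])
  ultimately show thesis by (rule that)
qed

lemma rank_upto_mono: "finite U \<Longrightarrow> i \<le> j \<Longrightarrow> rank_upto U i \<le> rank_upto U j"
  unfolding rank_upto_def by (intro card_mono) auto

lemma rank_upto_Suc: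
  assumes "finite U"
  shows "rank_upto U (Suc j) = rank_upto U j + (if Suc j \<in> U then 1 else 0)"
proof -
  have "{x \<in> U. x \<le> Suc j} = (if Suc j \<in> U then insert (Suc j) {x \<in> U. x \<le> j} else {x \<in> U. x \<le> j})"
    by (auto simp: le_Suc_eq)
  then show ?thesis using assms by (simp add: rank_upto_def)
qed

lemma rank_upto_full: "U \<subseteq> {1..n} \<Longrightarrow> rank_upto U n = card U"
  unfolding rank_upto_def by (rule arg_cong[of _ _ card]) auto

lemma rank_upto_0: "U \<subseteq> {1..n} \<Longrightarrow> rank_upto U 0 = 0"
  by (auto simp: rank_upto_def)

text \<open>
  Let \<open>j\<close> be the last place where the counts differ.  They agree at \<open>j +
  1\<close>, so \<open>j + 1\<close> does not belong to \<open>U\<close>, and the last element of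
  \<open>U\<close> up to \<open>j\<close> can be moved one step up without the count falling below
  that of \<open>V\<close>.
\<close>

lemma ex_movable_element:
  assumes U: "U \<subseteq> {1..n}" and V: "V \<subseteq> {1..n}" and card: "card U = card V" and "U \<noteq> V"
    and le: "\<And>j. rank_upto V j \<le> rank_upto U j"
  obtains a where "a \<in> U" "a + 1 \<notin> U" "rank_upto V a < rank_upto U a"
proof -
  have fin: "finite U" "finite V" using U V finite_subset by auto
  define J where "J = {j \<in> {..n}. rank_upto V j < rank_upto U j}"
  have "J \<noteq> {}"
  proof
    assume "J = {}"
    have eq: "rank_upto U j = rank_upto V j" if "j \<le> n" for j
    proof -
      have "j \<notin> J" using \<open>J = {}\<close> by blast
      with le[of j] that show ?thesis by (simp add: J_def)
    qed
    have "x \<in> U \<longleftrightarrow> x \<in> V" if x: "x \<in> {1..n}" for x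
    proof -
      from x obtain j where "x = Suc j" by (cases x) auto
      then show ?thesis
        using eq[of j] eq[of "Suc j"] x fin by (auto simp: rank_upto_Suc split: if_splits)
    qed
    with U V have "U = V" by blast
    with \<open>U \<noteq> V\<close> show False ..
  qed
  define j where "j = Max J"
  have "finite J" by (simp add: J_def)
  then have j: "j \<in> J" and jmax: "\<And>i. i \<in> J \<Longrightarrow> i \<le> j"
    using \<open>J \<noteq> {}\<close> by (auto simp: j_def)
  from j have jn: "j \<le> n" and jl: "rank_upto V j < rank_upto U j" by (auto simp: J_def)
  have "j \<noteq> n" using jl rank_upto_full[OF U] rank_upto_full[OF V] card by auto
  then have "rank_upto U (Suc j) \<le> rank_upto V (Suc j)"
    using jmax[of "Suc j"] jn by (intro leI notI) (simp add: J_def)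
  then have Sj: "Suc j \<notin> U"
    using jl fin by (auto simp: rank_upto_Suc split: if_splits)
  define a where "a = Max {x \<in> U. x \<le> j}"
  have "{x \<in> U. x \<le> j} \<noteq> {}"
    using jl unfolding rank_upto_def by (metis card.empty not_less0)
  then have a: "a \<in> {x \<in> U. x \<le> j}" and amax: "\<And>x. x \<in> U \<Longrightarrow> x \<le> j \<Longrightarrow> x \<le> a"
    using Max_in[of "{x \<in> U. x \<le> j}"] Max_ge[of "{x \<in> U. x \<le> j}"] fin
    by (auto simp: a_def simp del: Max_ge)
  have "{x \<in> U. x \<le> a} = {x \<in> U. x \<le> j}"
    using a amax by auto
  then have "rank_upto U a = rank_upto U j" by (simp add: rank_upto_def)
  moreover have "rank_upto V a \<le> rank_upto V j" using a fin by (intro rank_upto_mono) auto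
  moreover have "a + 1 \<notin> U"
    using a amax[of "a + 1"] Sj by (cases "a = j") auto
  ultimately show thesis using that[of a] a jl by simp
qed

lemma grassmannian_eqI:
  assumes u: "grassmannian n r u" and v: "grassmannian n r v"
    and eq: "u ` {1..r} = v ` {1..r}" and r: "r \<le> n"
  shows "u = v"
proof
  fix x
  have p: "u permutes {1..n}" "v permutes {1..n}"
    using u v by (auto simp: grassmannian_def)
  have compl: "w ` {Suc r..n} = {1..n} - w ` {1..r}" if "w permutes {1..n}" for w
  proof -
    have "{Suc r..n} = {1..n} - {1..r}" by auto
    then show ?thesis
      using image_set_diff[OF permutes_inj[OF that], of "{1..n}" "{1..r}"] permutes_image[OF that]
      by simp
  qed
  consider "x \<in> {1..r}" | "x \<in> {Suc r..n}" | "x \<notin> {1..n}" using r by force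
  then show "u x = v x"
  proof cases
    case 1
    then show ?thesis using u v eq strict_mono_on_eqI[of "{1..r}" u v] by (auto simp: grassmannian_def)
  next
    case 2
    then show ?thesis
      using u v strict_mono_on_eqI[of "{Suc r..n}" u v x] eq compl[OF p(1)] compl[OF p(2)]
      by (auto simp: grassmannian_def)
  next
    case 3
    then show ?thesis using p by (simp add: permutes_not_in)
  qed
qed

text \<open>
  The simple reflection that moves an element of \<open>U\<close> one step up is a Bruhat step
  between increasing representatives, and it lowers the counting function by one at one place
  only.  In terms of partitions, a box is added.
\<close>

lemma grassmannian_bruhat_le:
  assumes "grassmannian n r u" and v: "grassmannian n r v" and r: "r \<le> n"
    and "\<And>j. rank_upto (v ` {1..r}) j \<le> rank_upto (u ` {1..r}) j"
  shows "bruhat_le n u v"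
  using assms(1,4)
proof (induction "\<Sum>j\<le>n. rank_upto (u ` {1..r}) j" arbitrary: u rule: less_induct)
  case less
  let ?U = "u ` {1..r}" and ?V = "v ` {1..r}"
  have p: "u permutes {1..n}" "v permutes {1..n}"
    using less.prems v by (auto simp: grassmannian_def)
  have sub: "?U \<subseteq> {1..n}" "?V \<subseteq> {1..n}"
    using permutes_mem[OF p(1)] permutes_mem[OF p(2)] r by (auto simp del: atLeastAtMost_iff; force)+
  have card: "card ?U = r" "card ?V = r"
    using card_image[OF inj_on_subset[OF permutes_inj[OF p(1)]], of "{1..r}"]
      card_image[OF inj_on_subset[OF permutes_inj[OF p(2)]], of "{1..r}"] by auto
  show ?case
  proof (cases "?U = ?V")
    case True
    then have "u = v" by (intro grassmannian_eqI[OF less.prems(1) v _ r])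
    then show ?thesis by (simp add: bruhat_le_def)
  next
    case False
    then obtain a where a: "a \<in> ?U" "a + 1 \<notin> ?U" "rank_upto ?V a < rank_upto ?U a"
      using ex_movable_element[OF sub] card less.prems(2) by metis
    then obtain x where x: "x \<in> {1..r}" "u x = a" by blast
    define y where "y = inv' u (a + 1)"
    have "a \<noteq> n" using a(3) rank_upto_full[OF sub(1)] rank_upto_full[OF sub(2)] card by auto
    with a sub have an: "a \<in> {1..n-1}" by fastforce
    have uy: "u y = a + 1" by (simp add: y_def permutes_inverses[OF p(1)])
    have y: "y \<in> {1..n}"
      unfolding y_def by (rule permutes_mem[OF permutes_inv[OF p(1)]]) (use an in auto)
    with a(2) uy have "y \<notin> {1..r}" by force
    with y x r have xy: "x < y" "x \<in> {1..n}" "r < y" by auto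
    let ?u' = "simple_refl a \<circ> u"
    have "bruhat_step n u ?u'"
      by (rule bruhat_step_left[OF p(1) xy(2) x(2) y uy xy(1)])
    moreover have "bruhat_le n ?u' v"
    proof (rule less.hyps)
      have mono: "strict_mono_on A ?u'" if "strict_mono_on A u" "\<not> (x \<in> A \<and> y \<in> A)" for A
      proof (rule strict_mono_onI)
        fix i k assume ik: "i \<in> A" "k \<in> A" "i < k"
        then have "u i < u k" using that by (simp add: strict_mono_onD)
        moreover have "u i = a \<longleftrightarrow> i = x" "u k = a \<longleftrightarrow> k = x" "u i = a + 1 \<longleftrightarrow> i = y" "u k = a + 1 \<longleftrightarrow> k = y"
          using inj_eq[OF permutes_inj[OF p(1)], of _ x] inj_eq[OF permutes_inj[OF p(1)], of _ y] x uy
          by auto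
        ultimately show "?u' i < ?u' k"
          using simple_refl_less_iff[of "u i" "u k" a] that(2) ik by (auto simp: doubleton_eq_iff)
      qed
      show "grassmannian n r ?u'"
        using less.prems(1) permutes_compose[OF p(1) simple_refl_permutes[OF an]]
          mono[of "{1..r}"] mono[of "{Suc r..n}"] xy x by (auto simp: grassmannian_def)
      have U': "?u' ` {1..r} = insert (a + 1) (?U - {a})"
      proof -
        have "?u' ` {1..r} = simple_refl a ` ?U" by (simp only: image_comp)
        also have "\<dots> = insert (a + 1) (?U - {a})"
          using a(1,2) by (auto simp: simple_refl_def Transposition.transpose_def image_iff)
        finally show ?thesis .
      qed
      have rank': "rank_upto (?u' ` {1..r}) j = rank_upto ?U j - (if j = a then 1 else 0)" for j
      proof -
        have fin: "finite ?U" by simp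
        consider "j < a" | "j = a" | "a < j" by linarith
        then show ?thesis
        proof cases
          case 1
          then have "{z \<in> ?u' ` {1..r}. z \<le> j} = {z \<in> ?U. z \<le> j}" unfolding U' by auto
          with 1 show ?thesis by (simp add: rank_upto_def)
        next
          case 2
          then have "{z \<in> ?u' ` {1..r}. z \<le> j} = {z \<in> ?U. z \<le> j} - {a}" unfolding U' by auto
          with 2 a(1) show ?thesis by (simp add: rank_upto_def card_Diff_singleton)
        next
          case 3
          then have "{z \<in> ?u' ` {1..r}. z \<le> j} = insert (a + 1) ({z \<in> ?U. z \<le> j} - {a})"
            unfolding U' by auto
          moreover have "a + 1 \<notin> {z \<in> ?U. z \<le> j} - {a}" using a(2) by blast
          moreover have "a \<in> {z \<in> ?U. z \<le> j}" using a(1) 3 by simp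
          then have "card {z \<in> ?U. z \<le> j} > 0" unfolding card_gt_0_iff by fastforce
          ultimately show ?thesis using 3 a(1) by (simp add: rank_upto_def card_Diff_singleton)
        qed
      qed
      show "rank_upto ?V j \<le> rank_upto (?u' ` {1..r}) j" for j
        using less.prems(2)[of j] a(3) unfolding rank' by auto
      show "(\<Sum>j\<le>n. rank_upto (?u' ` {1..r}) j) < (\<Sum>j\<le>n. rank_upto ?U j)"
      proof (rule sum_strict_mono_ex1)
        show "\<exists>j\<in>{..n}. rank_upto (?u' ` {1..r}) j < rank_upto ?U j"
          using an a(3) unfolding rank' by (intro bexI[of _ a]) auto
        show "\<forall>j\<in>{..n}. rank_upto (?u' ` {1..r}) j \<le> rank_upto ?U j"
          unfolding rank' by simp
      qed simp
    qed
    ultimately show ?thesis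
      unfolding bruhat_le_def by (rule converse_rtranclp_into_rtranclp)
  qed
qed

section \<open>Matrices and the group $PSL(n,\<complex>)$\<close>

lemma SL_iff: "A \<in> carrier (SL n) \<longleftrightarrow> A \<in> carrier_mat n n \<and> det A = 1"
  by (simp add: SL_def)

lemma SL_dims: "A \<in> carrier (SL n) \<Longrightarrow> dim_row A = n" "A \<in> carrier (SL n) \<Longrightarrow> dim_col A = n"
  by (auto simp: SL_def)

lemma SL_mult_closed: "A \<in> carrier (SL n) \<Longrightarrow> B \<in> carrier (SL n) \<Longrightarrow> A * B \<in> carrier (SL n)"
  by (auto simp: SL_iff det_mult)

lemma proj_mult:
  assumes "A \<in> carrier (SL n)" "B \<in> carrier (SL n)"
  shows "proj n A \<otimes>\<^bsub>PSL n\<^esub> proj n B = proj n (A * B)"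
  using normal.rcos_sum[OF SL_centre_normal assms] by (simp add: PSL_def proj_def SL_def)

lemma carrier_PSL: "carrier (PSL n) = proj n ` carrier (SL n)"
  unfolding PSL_def carrier_FactGroup proj_def ..

lemma proj_self:
  assumes "A \<in> carrier (SL n)"
  shows "A \<in> proj n A"
  unfolding proj_def
  using group.rcos_self[OF SL_group assms] SL_centre_normal normal_imp_subgroup by blast

lemma one_PSL: "\<one>\<^bsub>PSL n\<^esub> = proj n (1\<^sub>m n)"
proof -
  have "SL_centre n #>\<^bsub>SL n\<^esub> \<one>\<^bsub>SL n\<^esub> = SL_centre n"
    using SL_centre_normal[of n] group.coset_mult_one[OF SL_group]
      subgroup.subset[OF normal_imp_subgroup] by blast
  then show ?thesis by (simp add: PSL_def proj_def SL_def)
qed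

lemma one_SL: "1\<^sub>m n \<in> carrier (SL n)"
  by (simp add: SL_iff)

lemma index_mult_mat_sum:
  assumes "A \<in> carrier_mat n n" "B \<in> carrier_mat n n" "i < n" "j < n"
  shows "(A * B) $$ (i, j) = (\<Sum>k<n. A $$ (i, k) * B $$ (k, j))"
  using assms by (auto simp: scalar_prod_def lessThan_atLeast0)

lemma index_mult_diagonal_left:
  assumes "diagonal_mat D" "D \<in> carrier_mat n n" "A \<in> carrier_mat n n" "i < n" "j < n"
  shows "(D * A) $$ (i, j) = D $$ (i, i) * A $$ (i, j)"
proof -
  have "(D * A) $$ (i, j) = (\<Sum>k<n. if k = i then D $$ (i, i) * A $$ (i, j) else 0)"
    unfolding index_mult_mat_sum[OF assms(2,3,4,5)]
    by (rule sum.cong) (use assms in \<open>auto simp: diagonal_mat_def\<close>)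
  then show ?thesis using assms by simp
qed

lemma index_mult_diagonal_right:
  assumes "diagonal_mat D" "D \<in> carrier_mat n n" "A \<in> carrier_mat n n" "i < n" "j < n"
  shows "(A * D) $$ (i, j) = A $$ (i, j) * D $$ (j, j)"
proof -
  have "(A * D) $$ (i, j) = (\<Sum>k<n. if k = j then A $$ (i, j) * D $$ (j, j) else 0)"
    unfolding index_mult_mat_sum[OF assms(3,2,4,5)]
    by (rule sum.cong) (use assms in \<open>auto simp: diagonal_mat_def\<close>)
  then show ?thesis using assms by simp
qed

lemma det_upper_triangular_prod:
  fixes A :: "complex mat"
  assumes "upper_triangular A" "A \<in> carrier_mat n n"
  shows "det A = (\<Prod>i<n. A $$ (i, i))"
  using det_upper_triangular[OF assms] assms(2)
  by (auto simp: prod_list_diag_prod lessThan_atLeast0)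

lemma diagonal_imp_upper_triangular: "diagonal_mat A \<Longrightarrow> A \<in> carrier_mat n n \<Longrightarrow> upper_triangular A"
  by (auto simp: diagonal_mat_def upper_triangular_def)

lemma diagonal_mat_diag: "diagonal_mat (mat_diag n f)"
  by (auto simp: diagonal_mat_def mat_diag_def)

lemma det_mat_diag: "det (mat_diag n f :: complex mat) = (\<Prod>i<n. f i)"
  by (subst det_upper_triangular_prod[OF diagonal_imp_upper_triangular[OF diagonal_mat_diag]])
    (auto simp: mat_diag_def)

lemma diagonal_SL_nonzero:
  assumes "A \<in> carrier (SL n)" "diagonal_mat A" "i < n"
  shows "A $$ (i, i) \<noteq> 0"
proof -
  have "(\<Prod>i<n. A $$ (i, i)) = 1"
    using det_upper_triangular_prod[OF diagonal_imp_upper_triangular] assms by (auto simp: SL_iff)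
  then show ?thesis using assms(3) by (metis finite_lessThan lessThan_iff prod_zero zero_neq_one)
qed

lemma torus_subset: "torus n \<subseteq> carrier (PSL n)"
  by (auto simp: torus_def carrier_PSL)

text \<open>
  Needed for two purposes: the subtorus generated by one-parameter subgroups stays inside
  \<open>T\<close>, and right multiplication by \<open>T\<close> fixes the points of
  \<open>G/P\<close>.
\<close>

lemma subgroup_torus: "subgroup (torus n) (PSL n)"
proof (rule group.subgroupI[OF PSL_group torus_subset])
  show "torus n \<noteq> {}"
    using one_SL by (force simp: torus_def diagonal_mat_def)
next
  fix g assume "g \<in> torus n"
  then obtain A where A: "A \<in> carrier (SL n)" "diagonal_mat A" "g = proj n A"
    by (auto simp: torus_def)
  define B where "B = mat_diag n (\<lambda>i. inverse (A $$ (i, i)))"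
  have Ac: "A \<in> carrier_mat n n" and Bc: "B \<in> carrier_mat n n" and Bd: "diagonal_mat B"
    using A by (auto simp: SL_iff B_def diagonal_mat_diag)
  have "B * A = 1\<^sub>m n"
  proof (rule eq_matI)
    fix i j assume "i < dim_row (1\<^sub>m n)" "j < dim_col (1\<^sub>m n)"
    then have ij: "i < n" "j < n" by auto
    then show "(B * A) $$ (i, j) = 1\<^sub>m n $$ (i, j)"
      using index_mult_diagonal_left[OF Bd Bc Ac ij] diagonal_SL_nonzero[OF A(1,2)] A(2) Ac
      by (auto simp: B_def mat_diag_def diagonal_mat_def)
  qed (use Ac Bc in auto)
  moreover from this have "B \<in> carrier (SL n)"
    using det_mult[OF Bc Ac] A(1) Bc by (simp add: SL_iff)
  ultimately have "proj n B \<otimes>\<^bsub>PSL n\<^esub> g = \<one>\<^bsub>PSL n\<^esub>" "proj n B \<in> torus n"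
    using A Bd by (auto simp: proj_mult one_PSL torus_def)
  then have "inv\<^bsub>PSL n\<^esub> g = proj n B"
    using torus_subset A by (intro group.inv_equality[OF PSL_group]) (auto simp: carrier_PSL torus_def)
  with \<open>proj n B \<in> torus n\<close> show "inv\<^bsub>PSL n\<^esub> g \<in> torus n" by simp
next
  fix g h assume "g \<in> torus n" "h \<in> torus n"
  then obtain A B where A: "A \<in> carrier (SL n)" "diagonal_mat A" "g = proj n A"
    and B: "B \<in> carrier (SL n)" "diagonal_mat B" "h = proj n B"
    by (auto simp: torus_def)
  have Ac: "A \<in> carrier_mat n n" and Bc: "B \<in> carrier_mat n n" using A B by (auto simp: SL_iff)
  have "diagonal_mat (A * B)"
    using A(2) B(2) Ac Bc index_mult_diagonal_left[OF A(2) Ac Bc]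
    by (auto simp: diagonal_mat_def simp del: index_mult_mat(1))
  then show "g \<otimes>\<^bsub>PSL n\<^esub> h \<in> torus n"
    using A B SL_mult_closed by (auto simp: proj_mult torus_def)
qed

lemma subtorus_subset_torus:
  assumes "J \<subseteq> {1..n-1}"
  shows "subtorus n J \<subseteq> torus n"
  unfolding subtorus_def
proof (rule group.generate_subgroup_incl[OF PSL_group _ subgroup_torus])
  show "(\<Union>j\<in>J. cochar n j ` (UNIV - {0})) \<subseteq> torus n"
    using assms simple_root_cochar(1) by blast
qed

lemma semistable_antimono:
  "H \<subseteq> H' \<Longrightarrow> semistable n r w H' \<subseteq> semistable n r w H"
  unfolding semistable_def invariant_section_def by blast

section \<open>Points of the Grassmannian and Schubert varieties\<close>

lemma parabolic_subset: "parabolic n r \<subseteq> carrier (PSL n)"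
  by (auto simp: parabolic_def carrier_PSL)

lemma torus_subset_parabolic: "torus n \<subseteq> parabolic n r"
proof
  fix g assume "g \<in> torus n"
  then obtain A where "A \<in> carrier (SL n)" "diagonal_mat A" "g = proj n A"
    by (auto simp: torus_def)
  then show "g \<in> parabolic n r"
    unfolding parabolic_def by (intro image_eqI[of _ _ A]) (auto simp: diagonal_mat_def SL_dims)
qed

lemma parabolic_mult_closed:
  assumes r: "r \<le> n" and "g \<in> parabolic n r" "h \<in> parabolic n r"
  shows "g \<otimes>\<^bsub>PSL n\<^esub> h \<in> parabolic n r"
proof -
  obtain A B where A: "A \<in> carrier (SL n)" "g = proj n A"
      "\<And>i j. r \<le> i \<Longrightarrow> i < n \<Longrightarrow> j < r \<Longrightarrow> A $$ (i, j) = 0"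
    and B: "B \<in> carrier (SL n)" "h = proj n B"
      "\<And>i j. r \<le> i \<Longrightarrow> i < n \<Longrightarrow> j < r \<Longrightarrow> B $$ (i, j) = 0"
    using assms(2,3) by (auto simp: parabolic_def)
  have "(A * B) $$ (i, j) = 0" if "r \<le> i" "i < n" "j < r" for i j
  proof -
    have "A $$ (i, k) * B $$ (k, j) = 0" if "k < n" for k
      using A(3)[of i k] B(3)[of k j] that \<open>r \<le> i\<close> \<open>i < n\<close> \<open>j < r\<close> by (cases "k < r") auto
    moreover have "A \<in> carrier_mat n n" "B \<in> carrier_mat n n" "j < n"
      using A(1) B(1) that r by (auto simp: SL_iff)
    ultimately show ?thesis
      using \<open>i < n\<close> by (simp only: index_mult_mat_sum[of A n B]) (auto intro!: sum.neutral)
  qed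
  then show ?thesis
    using A B SL_mult_closed by (auto simp: proj_mult parabolic_def)
qed

lemma flag_point_eq: "flag_point n r g = {g \<otimes>\<^bsub>PSL n\<^esub> p | p. p \<in> parabolic n r}"
  by (auto simp: flag_point_def l_coset_def)

lemma one_parabolic: "\<one>\<^bsub>PSL n\<^esub> \<in> parabolic n r"
  using subgroup.one_closed[OF subgroup_torus] torus_subset_parabolic by blast

lemma flag_point_self:
  assumes "g \<in> carrier (PSL n)"
  shows "g \<in> flag_point n r g"
proof -
  interpret group "PSL n" by (rule PSL_group)
  show ?thesis using r_one[OF assms] one_parabolic unfolding flag_point_eq by force
qed

lemma flag_point_torus:
  assumes r: "r \<le> n" and g: "g \<in> carrier (PSL n)" and h: "h \<in> torus n"
  shows "flag_point n r (g \<otimes>\<^bsub>PSL n\<^esub> h) = flag_point n r g"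
proof -
  interpret group "PSL n" by (rule PSL_group)
  have hc: "h \<in> carrier (PSL n)" and hp: "h \<in> parabolic n r" "inv\<^bsub>PSL n\<^esub> h \<in> parabolic n r"
    using h torus_subset torus_subset_parabolic subgroup.m_inv_closed[OF subgroup_torus h] by blast+
  have "g \<otimes>\<^bsub>PSL n\<^esub> h \<otimes>\<^bsub>PSL n\<^esub> p \<in> flag_point n r g" if p: "p \<in> parabolic n r" for p
    using parabolic_mult_closed[OF r hp(1) p] g hc p parabolic_subset
    unfolding flag_point_eq by (auto simp: m_assoc subset_iff)
  moreover have "g \<otimes>\<^bsub>PSL n\<^esub> p \<in> flag_point n r (g \<otimes>\<^bsub>PSL n\<^esub> h)" if p: "p \<in> parabolic n r" for p
  proof -
    have pc: "p \<in> carrier (PSL n)" using p parabolic_subset by blast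
    have "g \<otimes>\<^bsub>PSL n\<^esub> p = g \<otimes>\<^bsub>PSL n\<^esub> h \<otimes>\<^bsub>PSL n\<^esub> (inv\<^bsub>PSL n\<^esub> h \<otimes>\<^bsub>PSL n\<^esub> p)"
      using g hc pc by (simp add: m_assoc inv_solve_left' m_assoc[symmetric, of h])
    with parabolic_mult_closed[OF r hp(2) p] show ?thesis unfolding flag_point_eq by blast
  qed
  ultimately show ?thesis unfolding flag_point_eq[of n r g] flag_point_eq[of n r "g \<otimes>\<^bsub>PSL n\<^esub> h"]
    unfolding flag_point_eq by blast
qed

lemma borel_subset: "borel n \<subseteq> carrier (PSL n)"
  by (auto simp: borel_def carrier_PSL)

lemma weyl_coset_subset: "weyl_coset n w \<subseteq> carrier (PSL n)"
  by (auto simp: weyl_coset_def carrier_PSL)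

lemma schubert_cell_subset_variety: "schubert_cell n r w \<subseteq> schubert_variety n r w"
  by (auto simp: schubert_variety_def)

text \<open>
  An intersection of zero sets is the zero set of all regular functions that vanish on it.
\<close>

lemma zariski_closed_schubert_preimage: "zariski_closed n (schubert_preimage n r w)"
  unfolding zariski_closed_def
proof (intro exI conjI)
  \<comment> \<open>The largest possible system of equations: it contains the equations of every closed set that contains the cell.\<close>
  define F where "F = {\<phi>. regular_fun n \<phi> \<and> (\<forall>g \<in> schubert_preimage n r w. \<phi> g = 0)}"
  show "\<forall>\<phi>\<in>F. regular_fun n \<phi>" by (simp add: F_def)
  show "schubert_preimage n r w = {g \<in> carrier (PSL n). \<forall>\<phi>\<in>F. \<phi> g = 0}"
  proof (intro equalityI subsetI)
    fix g assume "g \<in> schubert_preimage n r w"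
    then show "g \<in> {g \<in> carrier (PSL n). \<forall>\<phi>\<in>F. \<phi> g = 0}"
      by (auto simp: F_def schubert_preimage_def)
  next
    fix g assume g: "g \<in> {g \<in> carrier (PSL n). \<forall>\<phi>\<in>F. \<phi> g = 0}"
    have "flag_point n r g \<in> Z" if Z: "flag_closed n r Z" "schubert_cell n r w \<subseteq> Z" for Z
    proof -
      from Z(1) obtain E where E: "\<forall>\<phi>\<in>E. regular_fun n \<phi>"
        "{g \<in> carrier (PSL n). flag_point n r g \<in> Z} = {g \<in> carrier (PSL n). \<forall>\<phi>\<in>E. \<phi> g = 0}"
        by (auto simp: flag_closed_def zariski_closed_def)
      have "schubert_preimage n r w \<subseteq> {g \<in> carrier (PSL n). flag_point n r g \<in> Z}"
        using Z by (auto simp: schubert_preimage_def schubert_variety_def)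
      then have "E \<subseteq> F" unfolding E(2) F_def using E(1) by blast
      with g have "g \<in> {g \<in> carrier (PSL n). \<forall>\<phi>\<in>E. \<phi> g = 0}" by blast
      then show ?thesis unfolding E(2)[symmetric] by blast
    qed
    with g show "g \<in> schubert_preimage n r w"
      by (auto simp: schubert_preimage_def schubert_variety_def)
  qed
qed

text \<open>
  The zeros of a section form a closed subset of the Schubert variety: the condition does not
  depend on the representative of a point, because the section transforms by a character.  If this
  subset contained the cell, it would be everything.
\<close>

lemma section_nonzero_on_cell:
  assumes f: "bundle_section n r w k f" and x: "x \<in> schubert_variety n r w" "g \<in> x" "f g \<noteq> 0"
  obtains b N where "b \<in> borel n" "N \<in> weyl_coset n w" "f (b \<otimes>\<^bsub>PSL n\<^esub> N) \<noteq> 0"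
proof (rule ccontr)
  assume no: "\<not> thesis"
  let ?Y = "schubert_preimage n r w"
  obtain \<phi> where \<phi>: "regular_fun n \<phi>" "\<And>g. g \<in> ?Y \<Longrightarrow> f g = \<phi> g"
    and eqv: "\<And>g p. g \<in> ?Y \<Longrightarrow> p \<in> parabolic n r \<Longrightarrow> f (g \<otimes>\<^bsub>PSL n\<^esub> p) = n_omega n r p ^ k * f g"
    using f by (auto simp: bundle_section_def)
  obtain F where F: "\<forall>\<phi>\<in>F. regular_fun n \<phi>" "?Y = {g \<in> carrier (PSL n). \<forall>\<phi>\<in>F. \<phi> g = 0}"
    using zariski_closed_schubert_preimage[of n r w] by (auto simp: zariski_closed_def)
  define Z where "Z = flag_point n r ` {g \<in> ?Y. f g = 0}"
  have zero: "f h = 0" if "h \<in> flag_point n r g'" "g' \<in> ?Y" "f g' = 0" for h g'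
    using that eqv[of g'] by (auto simp: flag_point_eq)
  have "{g \<in> carrier (PSL n). flag_point n r g \<in> Z} = {g \<in> ?Y. f g = 0}"
  proof (intro equalityI subsetI)
    fix h assume "h \<in> {g \<in> carrier (PSL n). flag_point n r g \<in> Z}"
    then obtain g' where h: "h \<in> carrier (PSL n)" and g': "g' \<in> ?Y" "f g' = 0"
      "flag_point n r h = flag_point n r g'" by (auto simp: Z_def)
    then show "h \<in> {g \<in> ?Y. f g = 0}"
      using flag_point_self[OF h, of r] zero[of h g'] by (auto simp: schubert_preimage_def)
  qed (auto simp: Z_def schubert_preimage_def)
  also have "\<dots> = {g \<in> carrier (PSL n). \<forall>\<psi>\<in>insert \<phi> F. \<psi> g = 0}"
    using \<phi>(2) F(2) by auto
  finally have "zariski_closed n {g \<in> carrier (PSL n). flag_point n r g \<in> Z}"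
    unfolding zariski_closed_def using F(1) \<phi>(1) by (intro exI[of _ "insert \<phi> F"]) auto
  moreover have "Z \<subseteq> flag_variety n r"
    by (auto simp: Z_def flag_variety_def schubert_preimage_def)
  ultimately have "flag_closed n r Z" by (simp add: flag_closed_def)
  moreover have "schubert_cell n r w \<subseteq> Z"
  proof
    fix y assume y: "y \<in> schubert_cell n r w"
    then obtain b N where bN: "b \<in> borel n" "N \<in> weyl_coset n w"
      "y = flag_point n r (b \<otimes>\<^bsub>PSL n\<^esub> N)"
      by (auto simp: schubert_cell_def set_mult_def)
    have "f (b \<otimes>\<^bsub>PSL n\<^esub> N) = 0" using no that bN by blast
    moreover have "b \<otimes>\<^bsub>PSL n\<^esub> N \<in> carrier (PSL n)"
      using group.is_monoid[OF PSL_group] bN borel_subset weyl_coset_subset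
      by (intro monoid.m_closed) blast+
    ultimately show "y \<in> Z"
      using bN y schubert_cell_subset_variety[of n r w] unfolding Z_def
      by (auto simp: schubert_preimage_def)
  qed
  ultimately have "schubert_variety n r w \<subseteq> Z" by (auto simp: schubert_variety_def)
  with x zero show False by (auto simp: Z_def)
qed

section \<open>The necessary condition for semistability\<close>

lemma continuous_mat_polys:
  assumes "p \<in> mat_polys n"
    and "\<And>i j. i < n \<Longrightarrow> j < n \<Longrightarrow> continuous_on UNIV (\<lambda>s. M s $$ (i, j))"
  shows "continuous_on UNIV (\<lambda>s :: complex. p (M s))"
  using assms(1) by induction (auto intro!: continuous_intros assms(2))

lemma prod_if_one: "finite A \<Longrightarrow> (\<Prod>i\<in>A. if P i then t else 1) = (t :: complex) ^ card {i \<in> A. P i}"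
  by (simp add: prod.inter_filter[symmetric])

text \<open>
  The scalar \<open>c\<close> that brings \<open>diag(t,\<dots>,t,1,\<dots>,1)\<close> into
  \<open>SL\<^sub>n\<close> enters the weight of the section through \<open>c ^ n\<close> only.
\<close>

lemma cochar_eq_proj:
  assumes j: "j \<in> {1..n-1}" and t: "t \<noteq> 0"
  obtains c where "c \<cdot>\<^sub>m mat_diag n (\<lambda>i. if i < j then t else 1) \<in> carrier (SL n)"
    "cochar n j t = proj n (c \<cdot>\<^sub>m mat_diag n (\<lambda>i. if i < j then t else 1))"
    "c ^ n * t ^ j = 1"
proof -
  from simple_root_cochar(1)[OF j j t] obtain A
    where A: "A \<in> carrier (SL n)" "cochar n j t = proj n A" by (auto simp: torus_def)
  then have "A \<in> cochar n j t" using proj_self by blast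
  then obtain c where c: "A = c \<cdot>\<^sub>m mat_diag n (\<lambda>i. if i < j then t else 1)"
    by (auto simp: cochar_def)
  have "{i \<in> {..<n}. i < j} = {..<j}" using j by auto
  then have "det A = c ^ n * t ^ j"
    unfolding c by (simp add: det_mat_diag prod_if_one) (simp add: mat_diag_def)
  with A c that[of c] show thesis by (simp add: SL_iff)
qed

lemma card_rank_upto_permutes:
  assumes "w permutes {1..n}"
  shows "card {m. m < r \<and> w (Suc m) \<le> j} = rank_upto (w ` {1..r}) j"
  unfolding rank_upto_def
proof (rule bij_betw_same_card)
  show "bij_betw (\<lambda>m. w (Suc m)) {m. m < r \<and> w (Suc m) \<le> j} {x \<in> w ` {1..r}. x \<le> j}"
    unfolding bij_betw_def
  proof
    show "inj_on (\<lambda>m. w (Suc m)) {m. m < r \<and> w (Suc m) \<le> j}"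
      using inj_eq[OF permutes_inj[OF assms]] by (auto intro!: inj_onI)
    have "{1..r} = Suc ` {..<r}" by (auto simp: image_Suc_lessThan)
    then show "(\<lambda>m. w (Suc m)) ` {m. m < r \<and> w (Suc m) \<le> j} = {x \<in> w ` {1..r}. x \<le> j}"
      by auto
  qed
qed

text \<open>
  This is the easy half of the Hilbert-Mumford criterion.  With \<open>s = 1 / t\<close>,
  conjugation by the inverse of \<open>\<lambda>\<^sub>j(t)\<close> multiplies the entries
  \<open>(a, c)\<close> of \<open>b\<close> with \<open>a \<le> j < c\<close> by \<open>s\<close>
  and leaves the other entries of the upper triangular matrix unchanged, so it extends
  continuously to \<open>s = 0\<close>.  If the claimed inequality failed, invariance would equate
  the nonzero value at \<open>b n\<^sub>w\<close> with a positive power of \<open>s\<close> times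
  a bounded quantity.
\<close>

lemma semistable_rank_bound:
  assumes w: "w permutes {1..n}" and r: "r \<le> n" and j: "j \<in> {1..n-1}"
    and H: "\<And>t. t \<noteq> 0 \<Longrightarrow> cochar n j t \<in> H"
    and ss: "semistable n r w H \<noteq> {}"
  shows "n * rank_upto (w ` {1..r}) j \<le> r * j"
proof (rule ccontr)
  let ?R = "rank_upto (w ` {1..r}) j" and ?Y = "schubert_preimage n r w"
  assume "\<not> n * ?R \<le> r * j"
  then obtain d where d: "n * ?R = r * j + d" "d > 0"
    by (metis less_imp_add_positive not_le)
  interpret group "PSL n" by (rule PSL_group)
  from ss obtain x k f g0 where k: "k > 0" and f: "bundle_section n r w k f"
    and inv: "invariant_section n r w H f" and x: "x \<in> schubert_variety n r w" "g0 \<in> x" "f g0 \<noteq> 0"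
    by (auto simp: semistable_def)
  obtain \<phi> where \<phi>: "regular_fun n \<phi>" "\<And>g. g \<in> ?Y \<Longrightarrow> f g = \<phi> g"
    and eqv: "\<And>g p. g \<in> ?Y \<Longrightarrow> p \<in> parabolic n r \<Longrightarrow> f (g \<otimes>\<^bsub>PSL n\<^esub> p) = n_omega n r p ^ k * f g"
    using f by (auto simp: bundle_section_def)
  obtain q where q: "q \<in> mat_polys n" "\<And>A. A \<in> carrier (SL n) \<Longrightarrow> \<phi> (proj n A) = q A"
    using \<phi>(1) by (auto simp: regular_fun_def)
  obtain b' N' where "b' \<in> borel n" "N' \<in> weyl_coset n w" and f0': "f (b' \<otimes>\<^bsub>PSL n\<^esub> N') \<noteq> 0"
    using section_nonzero_on_cell[OF f x] by blast
  then obtain b N where b: "b \<in> carrier (SL n)" "upper_triangular b" "b' = proj n b"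
    and N: "N \<in> carrier (SL n)" "N' = proj n N"
      "\<And>i j. i \<in> {1..n} \<Longrightarrow> j \<in> {1..n} \<Longrightarrow> N $$ (i - 1, j - 1) \<noteq> 0 \<longleftrightarrow> i = w j"
    by (auto simp: borel_def weyl_coset_def)
  have f0: "f (proj n (b * N)) \<noteq> 0" using f0' b N by (simp add: proj_mult)
  have bc: "b \<in> carrier_mat n n" and Nc: "N \<in> carrier_mat n n" using b N by (auto simp: SL_iff)
  have Nw: "Suc i = w (Suc m)" if "i < n" "m < n" "N $$ (i, m) \<noteq> 0" for i m
    using N(3)[of "Suc i" "Suc m"] that by simp
  have cell: "proj n (u * N) \<in> ?Y" if "u \<in> carrier (SL n)" "upper_triangular u" for u
  proof -
    have "proj n u \<in> borel n" "proj n N \<in> weyl_coset n w"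
      using that N by (auto simp: borel_def weyl_coset_def)
    then have "flag_point n r (proj n u \<otimes>\<^bsub>PSL n\<^esub> proj n N) \<in> schubert_cell n r w"
      by (auto simp: schubert_cell_def set_mult_def)
    then show ?thesis
      using that N SL_mult_closed schubert_cell_subset_variety[of n r w]
      by (auto simp: schubert_preimage_def proj_mult carrier_PSL)
  qed
  \<comment> \<open>The conjugate of \<open>b\<close>, with \<open>s\<close> in place of \<open>1 / t\<close>; positions are counted from \<open>0\<close>.\<close>
  define bs where "bs s = mat n n (\<lambda>(a, c). b $$ (a, c) * (if a < j \<and> j \<le> c then s else 1))" for s
  have bsc: "bs s \<in> carrier_mat n n" for s by (simp add: bs_def)
  have bsu: "upper_triangular (bs s)" for s
    using b(2) bc by (auto simp: upper_triangular_def bs_def)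
  have bsS: "bs s \<in> carrier (SL n)" for s
  proof -
    have "det (bs s) = det b"
      using det_upper_triangular_prod[OF bsu bsc] det_upper_triangular_prod[OF b(2) bc]
      by (auto simp: bs_def intro!: prod.cong)
    then show ?thesis using b(1) bsc by (simp add: SL_iff)
  qed
  have key: "f (proj n (b * N)) = s ^ (d * k) * q (bs s * N)" if s: "s \<noteq> 0" for s
  proof -
    let ?t = "inverse s"
    have t: "?t \<noteq> 0" using s by simp
    obtain c where c: "c \<cdot>\<^sub>m mat_diag n (\<lambda>i. if i < j then ?t else 1) \<in> carrier (SL n)"
      "cochar n j ?t = proj n (c \<cdot>\<^sub>m mat_diag n (\<lambda>i. if i < j then ?t else 1))"
      "c ^ n * ?t ^ j = 1"
      using cochar_eq_proj[OF j t] by blast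
    define A where "A = mat_diag n (\<lambda>i. c * (if i < j then ?t else 1))"
    have A': "c \<cdot>\<^sub>m mat_diag n (\<lambda>i. if i < j then ?t else 1) = A"
      by (rule eq_matI) (auto simp: A_def mat_diag_def)
    have A: "A \<in> carrier (SL n)" "cochar n j ?t = proj n A" using c A' by auto
    have Ac: "A \<in> carrier_mat n n" and Ad: "diagonal_mat A"
      by (auto simp: A_def diagonal_mat_diag)
    have Aii: "A $$ (i, i) = c * (if i < j then ?t else 1)" if "i < n" for i
      using that by (simp add: A_def mat_diag_def)
    \<comment> \<open>The conjugate of \<open>A\<close> by \<open>N\<close>, an element of \<open>T\<close> and so of \<open>P\<close>, on which the character is evaluated.\<close>
    define D where "D = mat_diag n (\<lambda>m. c * (if w (Suc m) \<le> j then ?t else 1))"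
    have Dc: "D \<in> carrier_mat n n" and Dd: "diagonal_mat D"
      by (auto simp: D_def diagonal_mat_diag)
    have Dii: "D $$ (i, i) = c * (if w (Suc i) \<le> j then ?t else 1)" if "i < n" for i
      using that by (simp add: D_def mat_diag_def)
    have AN: "A * N = N * D"
    proof (rule eq_matI)
      fix i m assume "i < dim_row (N * D)" "m < dim_col (N * D)"
      then have im: "i < n" "m < n" using Nc Dc by auto
      show "(A * N) $$ (i, m) = (N * D) $$ (i, m)"
        using Nw[OF im] index_mult_diagonal_left[OF Ad Ac Nc im]
          index_mult_diagonal_right[OF Dd Dc Nc im] im
        by (cases "N $$ (i, m) = 0") (auto simp: Aii Dii simp del: index_mult_mat(1))
    qed (use Ac Nc Dc in auto)
    have D: "D \<in> carrier (SL n)"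
      using arg_cong[OF AN, of det] A(1) N(1) Dc Nc Ac by (simp add: SL_iff det_mult[of _ n])
    have Ab: "A * bs s = b * A"
    proof (rule eq_matI)
      fix i m assume "i < dim_row (b * A)" "m < dim_col (b * A)"
      then have im: "i < n" "m < n" using bc Ac by auto
      have "b $$ (i, m) = 0" if "m < i" using b(2) bc im that by (auto simp: upper_triangular_def)
      then show "(A * bs s) $$ (i, m) = (b * A) $$ (i, m)"
        using index_mult_diagonal_left[OF Ad Ac bsc im]
          index_mult_diagonal_right[OF Ad Ac bc im] im s
        by (cases "m < i") (auto simp: Aii bs_def simp del: index_mult_mat(1))
    qed (use Ac bc bsc[of s] in auto)
    \<comment> \<open>Moving the conjugated point by \<open>\<lambda>\<^sub>j(t)\<close> gives the original point up to right multiplication by \<open>D\<close>.\<close>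
    let ?h = "cochar n j ?t" and ?g = "proj n (bs s * N)"
    have hg: "?h \<otimes>\<^bsub>PSL n\<^esub> ?g = proj n (b * N) \<otimes>\<^bsub>PSL n\<^esub> proj n D"
    proof -
      have "A * (bs s * N) = (A * bs s) * N" using Ac bsc Nc by (simp add: assoc_mult_mat[of _ n n _ n _ n])
      also have "\<dots> = b * (A * N)" unfolding Ab using Ac bc Nc by (simp add: assoc_mult_mat[of _ n n _ n _ n])
      also have "\<dots> = (b * N) * D" unfolding AN using Dc bc Nc by (simp add: assoc_mult_mat[of _ n n _ n _ n])
      finally show ?thesis
        using A(1) bsS N(1) b(1) D by (simp add: A(2) proj_mult SL_mult_closed)
    qed
    have DT: "proj n D \<in> torus n" using D Dd by (auto simp: torus_def)
    have bN: "proj n (b * N) \<in> ?Y" by (rule cell[OF b(1,2)])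
    have gc: "?g \<in> carrier (PSL n)" and hc: "?h \<in> carrier (PSL n)"
      using bsS N A by (auto simp: carrier_PSL SL_mult_closed)
    have "?h \<otimes>\<^bsub>PSL n\<^esub> ?g \<in> ?Y"
      using bN flag_point_torus[OF r _ DT] subsetD[OF torus_subset DT]
      unfolding hg schubert_preimage_def by auto
    then have "f (inv\<^bsub>PSL n\<^esub> ?h \<otimes>\<^bsub>PSL n\<^esub> (?h \<otimes>\<^bsub>PSL n\<^esub> ?g)) = f (?h \<otimes>\<^bsub>PSL n\<^esub> ?g)"
      using inv H[OF t] by (auto simp: invariant_section_def)
    also have "inv\<^bsub>PSL n\<^esub> ?h \<otimes>\<^bsub>PSL n\<^esub> (?h \<otimes>\<^bsub>PSL n\<^esub> ?g) = ?g"
      using gc hc by (simp add: m_assoc[symmetric])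
    also have "f (?h \<otimes>\<^bsub>PSL n\<^esub> ?g) = n_omega n r (proj n D) ^ k * f (proj n (b * N))"
      unfolding hg using DT torus_subset_parabolic by (intro eqv[OF bN]) auto
    also have "n_omega n r (proj n D) = ?t ^ d"
    proof -
      have "mat r r (\<lambda>(i, j). D $$ (i, j)) = mat_diag r (\<lambda>m. c * (if w (Suc m) \<le> j then ?t else 1))"
        using r by (intro eq_matI) (auto simp: D_def mat_diag_def)
      then have "n_omega n r (proj n D) = (c ^ r * ?t ^ ?R) ^ n"
        using n_omega_proj[OF D r]
        by (simp add: det_mat_diag prod.distrib prod_if_one card_rank_upto_permutes[OF w])
      also have "\<dots> = (c ^ n) ^ r * ?t ^ (n * ?R)"
        by (simp add: power_mult_distrib mult.commute flip: power_mult)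
      also have "\<dots> = (c ^ n * ?t ^ j) ^ r * ?t ^ d"
        unfolding d(1) mult.commute[of r j]
        by (simp only: power_mult_distrib power_add power_mult mult.assoc)
      finally show ?thesis using c(3) by simp
    qed
    also have "f ?g = q (bs s * N)"
      using \<phi>(2)[OF cell[OF bsS bsu]] q(2) bsS N SL_mult_closed by simp
    finally show ?thesis
      using s by (simp add: power_mult field_simps)
  qed
  have "continuous_on UNIV (\<lambda>s. q (bs s * N))"
  proof (rule continuous_mat_polys[OF q(1)])
    fix i m assume im: "i < n" "m < n"
    have "(bs s * N) $$ (i, m)
        = (\<Sum>k<n. b $$ (i, k) * (if i < j \<and> j \<le> k then s else 1) * N $$ (k, m))" for s
      using im by (subst index_mult_mat_sum[OF bsc Nc]) (auto simp: bs_def)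
    moreover have "continuous_on UNIV (\<lambda>s. if P then s else 1 :: complex)" for P
      by (cases P) auto
    then have "continuous_on UNIV
        (\<lambda>s. \<Sum>k<n. b $$ (i, k) * (if i < j \<and> j \<le> k then s else 1) * N $$ (k, m))"
      by (intro continuous_intros)
    ultimately show "continuous_on UNIV (\<lambda>s. (bs s * N) $$ (i, m))" by simp
  qed
  then have "isCont (\<lambda>s. s ^ (d * k) * q (bs s * N)) 0"
    by (intro continuous_intros) (simp add: continuous_on_eq_continuous_at)
  then have "((\<lambda>s. s ^ (d * k) * q (bs s * N)) \<longlongrightarrow> 0) (at 0)"
    using d(2) k by (simp add: isCont_def power_0_left)
  moreover have "\<forall>\<^sub>F s in at 0. s ^ (d * k) * q (bs s * N) = f (proj n (b * N))"
    using key by (auto simp: eventually_at_filter)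
  ultimately have "((\<lambda>s :: complex. f (proj n (b * N))) \<longlongrightarrow> 0) (at 0)"
    by (rule Lim_transform_eventually)
  then show False using f0 by (simp add: tendsto_const_iff)
qed

section \<open>An invariant product of Pluecker coordinates\<close>

text \<open>
  The \<open>k\<close>-th row, counted from \<open>0\<close>, of the \<open>m\<close>-th of the
  \<open>n\<close> Pluecker coordinates in the invariant product.  Every \<open>x < r * n\<close>
  has a unique form \<open>k * n + m\<close> with \<open>k < r\<close> and \<open>m < n\<close>,
  and exactly \<open>r\<close> of these \<open>x\<close> have a given quotient by
  \<open>r\<close>; this is why the rows of all coordinates together are equidistributed.
\<close>

definition balanced_row :: "nat \<Rightarrow> nat \<Rightarrow> nat \<Rightarrow> nat \<Rightarrow> nat" where
  "balanced_row n r m k = (k * n + m) div r"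

text \<open>
  For increasing \<open>e\<close>, the Pluecker coordinate of the set \<open>e ` {..<r}\<close>.
\<close>

definition first_cols_minor :: "nat \<Rightarrow> (nat \<Rightarrow> nat) \<Rightarrow> complex mat \<Rightarrow> complex" where
  "first_cols_minor r e A = det (mat r r (\<lambda>(k, l). A $$ (e k, l)))"

definition balanced_product :: "nat \<Rightarrow> nat \<Rightarrow> complex mat \<Rightarrow> complex" where
  "balanced_product n r A = (\<Prod>m<n. first_cols_minor r (balanced_row n r m) A)"

lemma balanced_row_less: "m < n \<Longrightarrow> k < r \<Longrightarrow> balanced_row n r m k < n"
proof -
  assume m: "m < n" and k: "k < r"
  have "k * n + m < Suc k * n" using m by simp
  also have "\<dots> \<le> r * n" using k by (intro mult_le_mono1) simp
  finally show ?thesis by (simp add: balanced_row_def less_mult_imp_div_less mult.commute)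
qed

lemma balanced_row_strict_mono:
  assumes "0 < r" "r \<le> n" "k < l"
  shows "balanced_row n r m k < balanced_row n r m l"
proof -
  have "k * n + m + r \<le> Suc k * n + m" using assms by simp
  also have "\<dots> \<le> l * n + m" using assms(3) by (intro add_mono mult_le_mono1) simp_all
  finally have "(k * n + m + r) div r \<le> (l * n + m) div r" by (rule div_le_mono)
  then show ?thesis using assms(1) by (simp add: balanced_row_def)
qed

lemma prod_lessThan_mult:
  fixes f :: "nat \<Rightarrow> 'a :: comm_monoid_mult"
  shows "(\<Prod>k<r. \<Prod>m<n. f (k * n + m)) = (\<Prod>x<r * n. f x)"
proof -
  have "(\<Prod>m<n. f (k * n + m)) = prod f {k * n..<k * n + n}" for k
    using prod.shift_bounds_nat_ivl[of f 0 "k * n" n] by (simp add: lessThan_atLeast0 add.commute)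
  then show ?thesis using prod.nat_group[of f n r] by simp
qed

text \<open>
  Both sides run through the numbers below \<open>r * n\<close>, once sorted by residue modulo
  \<open>n\<close> and once by quotient by \<open>r\<close>.
\<close>

lemma prod_balanced_row:
  fixes d :: "nat \<Rightarrow> 'a :: comm_semiring_1"
  assumes r: "0 < r"
  shows "(\<Prod>m<n. \<Prod>k<r. d (balanced_row n r m k)) = (\<Prod>i<n. d i) ^ r"
proof -
  have "(\<Prod>m<n. \<Prod>k<r. d (balanced_row n r m k)) = (\<Prod>k<r. \<Prod>m<n. d ((k * n + m) div r))"
    unfolding balanced_row_def by (rule prod.swap)
  also have "\<dots> = (\<Prod>x<n * r. d (x div r))"
    using prod_lessThan_mult[of "\<lambda>x. d (x div r)" n r] by (simp add: mult.commute)
  also have "\<dots> = (\<Prod>i<n. \<Prod>y<r. d ((i * r + y) div r))"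
    using prod_lessThan_mult[of "\<lambda>x. d (x div r)" r n] by simp
  also have "\<dots> = (\<Prod>i<n. \<Prod>y<r. d i)"
    using r by (intro prod.cong) auto
  finally show ?thesis by (simp add: prod_power_distrib)
qed

lemma mat_polys_sum:
  "finite S \<Longrightarrow> (\<And>s. s \<in> S \<Longrightarrow> (\<lambda>A. p s A) \<in> mat_polys n) \<Longrightarrow> (\<lambda>A. \<Sum>s\<in>S. p s A) \<in> mat_polys n"
  by (induction S rule: finite_induct) (auto intro: mat_polys.intros)

lemma mat_polys_prod:
  "finite S \<Longrightarrow> (\<And>s. s \<in> S \<Longrightarrow> (\<lambda>A. p s A) \<in> mat_polys n) \<Longrightarrow> (\<lambda>A. \<Prod>s\<in>S. p s A) \<in> mat_polys n"
  by (induction S rule: finite_induct) (auto intro: mat_polys.intros)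

lemma first_cols_minor_mat_polys:
  assumes "\<And>k. k < r \<Longrightarrow> e k < n" and r: "r \<le> n"
  shows "first_cols_minor r e \<in> mat_polys n"
proof -
  have eq: "first_cols_minor r e
    = (\<lambda>A. \<Sum>p\<in>{p. p permutes {0..<r}}. signof p * (\<Prod>k = 0..<r. A $$ (e k, p k)))"
  proof
    fix A :: "complex mat"
    have "(\<Prod>k = 0..<r. mat r r (\<lambda>(k, l). A $$ (e k, l)) $$ (k, p k)) = (\<Prod>k = 0..<r. A $$ (e k, p k))"
      if "p permutes {0..<r}" for p
      using permutes_mem[OF that] by (intro prod.cong) auto
    then show "first_cols_minor r e A
      = (\<Sum>p\<in>{p. p permutes {0..<r}}. signof p * (\<Prod>k = 0..<r. A $$ (e k, p k)))"
      unfolding first_cols_minor_def by (subst det_def'[of _ r]) auto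
  qed
  have "p k < n" if "p permutes {0..<r}" "k \<in> {0..<r}" for p k
    using permutes_mem[OF that] r by simp
  then show ?thesis
    unfolding eq using assms(1)
    by (intro mat_polys_sum mat_polys.mult mat_polys_prod mat_polys.const mat_polys.entry
        finite_permutations) auto
qed

lemma first_cols_minor_mult_parabolic:
  assumes A: "A \<in> carrier_mat n n" and P: "P \<in> carrier_mat n n" and r: "r \<le> n"
    and e: "\<And>k. k < r \<Longrightarrow> e k < n"
    and zero: "\<And>i j. r \<le> i \<Longrightarrow> i < n \<Longrightarrow> j < r \<Longrightarrow> P $$ (i, j) = 0"
  shows "first_cols_minor r e (A * P)
    = first_cols_minor r e A * det (mat r r (\<lambda>(i, j). P $$ (i, j)))"
proof -
  let ?A = "mat r r (\<lambda>(k, l). A $$ (e k, l))" and ?P = "mat r r (\<lambda>(i, j). P $$ (i, j))"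
  have "mat r r (\<lambda>(k, l). (A * P) $$ (e k, l)) = ?A * ?P"
  proof (rule eq_matI)
    fix k l assume "k < dim_row (?A * ?P)" "l < dim_col (?A * ?P)"
    then have kl: "k < r" "l < r" by auto
    have "(A * P) $$ (e k, l) = (\<Sum>i<n. A $$ (e k, i) * P $$ (i, l))"
      using e[OF kl(1)] kl r by (intro index_mult_mat_sum[OF A P]) auto
    also have "\<dots> = (\<Sum>i<r. A $$ (e k, i) * P $$ (i, l))"
      by (rule sum.mono_neutral_right) (use r zero kl in auto)
    also have "\<dots> = (?A * ?P) $$ (k, l)"
      using kl by (subst index_mult_mat_sum[of _ r]) auto
    finally show "mat r r (\<lambda>(k, l). (A * P) $$ (e k, l)) $$ (k, l) = (?A * ?P) $$ (k, l)"
      using kl by simp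
  qed auto
  then show ?thesis by (simp add: first_cols_minor_def det_mult[of _ r])
qed

lemma first_cols_minor_mult_diagonal:
  assumes D: "diagonal_mat D" "D \<in> carrier_mat n n" and A: "A \<in> carrier_mat n n" and r: "r \<le> n"
    and e: "\<And>k. k < r \<Longrightarrow> e k < n"
  shows "first_cols_minor r e (D * A) = (\<Prod>k<r. D $$ (e k, e k)) * first_cols_minor r e A"
proof -
  let ?A = "mat r r (\<lambda>(k, l). A $$ (e k, l))" and ?D = "mat_diag r (\<lambda>k. D $$ (e k, e k))"
  have "mat r r (\<lambda>(k, l). (D * A) $$ (e k, l)) = ?D * ?A"
  proof (rule eq_matI)
    fix k l assume "k < dim_row (?D * ?A)" "l < dim_col (?D * ?A)"
    then have kl: "k < r" "l < r" by (auto simp: mat_diag_def)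
    have "(D * A) $$ (e k, l) = D $$ (e k, e k) * A $$ (e k, l)"
      using e[OF kl(1)] kl r by (intro index_mult_diagonal_left[OF D A]) auto
    also have "\<dots> = (?D * ?A) $$ (k, l)"
      using kl index_mult_diagonal_left[OF diagonal_mat_diag[of r "\<lambda>k. D $$ (e k, e k)"], of r ?A k l]
      by (simp add: mat_diag_def)
    finally show "mat r r (\<lambda>(k, l). (D * A) $$ (e k, l)) $$ (k, l) = (?D * ?A) $$ (k, l)"
      using kl by simp
  qed (auto simp: mat_diag_def)
  then show ?thesis by (simp add: first_cols_minor_def det_mult[of _ r] det_mat_diag)
qed

lemma first_cols_minor_smult:
  assumes "A \<in> carrier_mat n n" "r \<le> n" "\<And>k. k < r \<Longrightarrow> e k < n"
  shows "first_cols_minor r e (z \<cdot>\<^sub>m A) = z ^ r * first_cols_minor r e A"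
proof -
  have "mat r r (\<lambda>(k, l). (z \<cdot>\<^sub>m A) $$ (e k, l)) = z \<cdot>\<^sub>m mat r r (\<lambda>(k, l). A $$ (e k, l))"
    using assms by (intro eq_matI) auto
  then show ?thesis by (simp add: first_cols_minor_def)
qed

text \<open>
  The product is homogeneous of degree \<open>r * n\<close>, hence constant on cosets of the
  centre, and \<open>the_elem\<close> picks its value.
\<close>

definition balanced_section :: "nat \<Rightarrow> nat \<Rightarrow> complex mat set \<Rightarrow> complex" where
  "balanced_section n r g = the_elem (balanced_product n r ` g)"

lemma balanced_section_proj:
  assumes A: "A \<in> carrier (SL n)" and r: "r \<le> n"
  shows "balanced_section n r (proj n A) = balanced_product n r A"
proof -
  have Ac: "A \<in> carrier_mat n n" using A by (simp add: SL_iff)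
  have "balanced_product n r B = balanced_product n r A" if B: "B \<in> proj n A" for B
  proof -
    from B obtain z where z: "z ^ n = 1" "B = (z \<cdot>\<^sub>m 1\<^sub>m n) * A"
      by (auto simp: proj_def r_coset_def SL_centre_def SL_def)
    then have "B = z \<cdot>\<^sub>m A"
      using Ac by (simp add: mult_smult_assoc_mat[of _ n n _ n])
    moreover have "first_cols_minor r (balanced_row n r m) (z \<cdot>\<^sub>m A)
        = z ^ r * first_cols_minor r (balanced_row n r m) A" if "m < n" for m
      by (rule first_cols_minor_smult[OF Ac r balanced_row_less[OF that]])
    ultimately have "balanced_product n r B = (z ^ n) ^ r * balanced_product n r A"
      by (simp add: balanced_product_def prod.distrib power_commutes mult.commute flip: power_mult)
    with z show ?thesis by simp
  qed
  with proj_self[OF A] have "balanced_product n r ` proj n A = {balanced_product n r A}" by blast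
  then show ?thesis by (simp add: balanced_section_def)
qed

text \<open>
  Each of the \<open>n\<close> minors contributes one factor \<open>\<omega>\<^sub>r\<close>, so
  the product is a section of the bundle of \<open>n\<omega>\<^sub>r\<close> itself.
\<close>

lemma bundle_section_balanced:
  assumes r: "0 < r" "r \<le> n"
  shows "bundle_section n r w 1 (balanced_section n r)"
proof -
  have "regular_fun n (balanced_section n r)"
    unfolding regular_fun_def
  proof (intro bexI ballI)
    show "balanced_section n r (proj n A) = balanced_product n r A" if "A \<in> carrier (SL n)" for A
      by (rule balanced_section_proj[OF that r(2)])
    show "balanced_product n r \<in> mat_polys n"
      unfolding balanced_product_def[abs_def]
      by (rule mat_polys_prod) (auto intro: first_cols_minor_mat_polys balanced_row_less r)
  qed
  moreover have "balanced_section n r (g \<otimes>\<^bsub>PSL n\<^esub> p) = n_omega n r p * balanced_section n r g"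
    if "g \<in> carrier (PSL n)" "p \<in> parabolic n r" for g p
  proof -
    from that obtain A P where A: "A \<in> carrier (SL n)" "g = proj n A"
      and P: "P \<in> carrier (SL n)" "p = proj n P"
      "\<And>i j. r \<le> i \<Longrightarrow> i < n \<Longrightarrow> j < r \<Longrightarrow> P $$ (i, j) = 0"
      by (auto simp: carrier_PSL parabolic_def)
    have "A \<in> carrier_mat n n" "P \<in> carrier_mat n n" using A P by (auto simp: SL_iff)
    from first_cols_minor_mult_parabolic[OF this r(2) balanced_row_less P(3)]
    have "balanced_product n r (A * P)
      = balanced_product n r A * det (mat r r (\<lambda>(i, j). P $$ (i, j))) ^ n"
      by (simp add: balanced_product_def prod.distrib)
    then show ?thesis
      using A P r by (simp add: proj_mult balanced_section_proj SL_mult_closed n_omega_proj)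
  qed
  ultimately show ?thesis
    unfolding bundle_section_def by (auto simp: schubert_preimage_def)
qed

text \<open>
  Each diagonal entry of the torus element occurs exactly \<open>r\<close> times, so the weight is
  the \<open>r\<close>-th power of the determinant.
\<close>

lemma invariant_section_balanced:
  assumes r: "0 < r" "r \<le> n"
  shows "invariant_section n r w (torus n) (balanced_section n r)"
proof -
  interpret group "PSL n" by (rule PSL_group)
  have inv: "balanced_section n r (h \<otimes>\<^bsub>PSL n\<^esub> g) = balanced_section n r g"
    if "g \<in> carrier (PSL n)" "h \<in> torus n" for g h
  proof -
    from that obtain A D where A: "A \<in> carrier (SL n)" "g = proj n A"
      and D: "D \<in> carrier (SL n)" "h = proj n D" "diagonal_mat D"
      by (auto simp: carrier_PSL torus_def)
    have Ac: "A \<in> carrier_mat n n" and Dc: "D \<in> carrier_mat n n" using A D by (auto simp: SL_iff)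
    have "balanced_product n r (D * A)
      = (\<Prod>m<n. \<Prod>k<r. D $$ (balanced_row n r m k, balanced_row n r m k)) * balanced_product n r A"
      using first_cols_minor_mult_diagonal[OF D(3) Dc Ac r(2) balanced_row_less]
      by (simp add: balanced_product_def prod.distrib)
    also have "(\<Prod>m<n. \<Prod>k<r. D $$ (balanced_row n r m k, balanced_row n r m k))
      = (\<Prod>i<n. D $$ (i, i)) ^ r"
      using prod_balanced_row[OF r(1), of "\<lambda>i. D $$ (i, i)" n] by simp
    also have "(\<Prod>i<n. D $$ (i, i)) = 1"
      using det_upper_triangular_prod[OF diagonal_imp_upper_triangular[OF D(3) Dc] Dc] D(1)
      by (simp add: SL_iff)
    finally show ?thesis
      using A D r by (simp add: proj_mult balanced_section_proj SL_mult_closed)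
  qed
  show ?thesis
    unfolding invariant_section_def
    using inv subgroup.m_inv_closed[OF subgroup_torus]
    by (auto simp: schubert_preimage_def)
qed

lemma prod_monom: "finite S \<Longrightarrow> (\<Prod>s\<in>S. monom (1 :: 'a :: comm_ring_1) (h s)) = monom 1 (\<Sum>s\<in>S. h s)"
  by (induction S rule: finite_induct) (auto simp: mult_monom)

section \<open>A point where the invariant product does not vanish\<close>

text \<open>
  The powers of two make products of distinct entries distinguishable by their degree in
  \<open>x\<close>.  The definition is polymorphic in order to be used with a polynomial
  indeterminate as well as with its specialisation to a complex number.
\<close>

definition generic_entry :: "'a :: comm_ring_1 \<Rightarrow> nat \<Rightarrow> nat \<Rightarrow> 'a" where
  "generic_entry x a c = (if a \<le> c then x ^ (2 ^ prod_encode (a, c)) else 0)"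

text \<open>
  By uniqueness of binary expansions, the exponent of a term in the expansion of the determinant
  determines the set of positions used, hence the permutation.  The term of the identity, which is
  nonzero because \<open>e k \<le> e' k\<close>, therefore cannot be cancelled.
\<close>

lemma generic_minor_poly_nonzero:
  fixes e e' :: "nat \<Rightarrow> nat"
  assumes inj: "inj_on e {..<r}" "inj_on e' {..<r}" and le: "\<And>k. k < r \<Longrightarrow> e k \<le> e' k"
  shows "det (mat r r (\<lambda>(k, l). generic_entry (monom (1 :: complex) 1) (e k) (e' l))) \<noteq> 0"
proof -
  let ?x = "monom (1 :: complex) 1"
  let ?code = "\<lambda>p k. prod_encode (e k, e' (p k))"
  define E where "E p = (\<Sum>k = 0..<r. 2 ^ ?code p k :: nat)" for p
  \<comment> \<open>The exponent is the number whose binary digits mark the positions used by \<open>p\<close>.\<close>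
  have E_encode: "E p = set_encode (?code p ` {0..<r})" for p
  proof -
    have "inj_on (?code p) {0..<r}"
      using inj(1) by (auto simp: inj_on_def prod_encode_eq)
    then show ?thesis by (simp add: E_def set_encode_def sum.reindex)
  qed
  have E_id: "p = id" if p: "p permutes {0..<r}" and "E p = E id" for p
  proof
    fix k
    show "p k = id k"
    proof (cases "k < r")
      case True
      have "?code p ` {0..<r} = ?code id ` {0..<r}"
        using \<open>E p = E id\<close> set_encode_eq[of "?code p ` {0..<r}" "?code id ` {0..<r}"]
        unfolding E_encode by blast
      moreover have "?code p k \<in> ?code p ` {0..<r}" using True by (intro imageI) simp
      ultimately have "?code p k \<in> ?code id ` {0..<r}" by blast
      then obtain k' where k': "k' < r" "e k = e k'" "e' (p k) = e' k'"
        by (auto simp: prod_encode_eq)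
      have "p k < r" using permutes_mem[OF p, of k] True by simp
      then have "k' = k" "p k = k'"
        using k' True inj by (auto simp: inj_on_def)
      then show ?thesis by simp
    qed (use p in \<open>simp add: permutes_not_in\<close>)
  qed
  have summand: "(\<Prod>k = 0..<r. generic_entry ?x (e k) (e' (p k)))
    = (if \<forall>k<r. e k \<le> e' (p k) then monom 1 (E p) else 0)" for p
  proof (cases "\<forall>k<r. e k \<le> e' (p k)")
    case True
    then have "(\<Prod>k = 0..<r. generic_entry ?x (e k) (e' (p k))) = (\<Prod>k = 0..<r. monom 1 (2 ^ ?code p k))"
      by (intro prod.cong) (auto simp: generic_entry_def monom_power)
    with True show ?thesis by (simp add: prod_monom E_def)
  next
    case False
    then show ?thesis by (auto simp: generic_entry_def intro!: prod_zero)
  qed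
  let ?M = "mat r r (\<lambda>(k, l). generic_entry ?x (e k) (e' l))"
  have "(\<Prod>k = 0..<r. ?M $$ (k, p k)) = (if \<forall>k<r. e k \<le> e' (p k) then monom 1 (E p) else 0)"
    if "p permutes {0..<r}" for p
    unfolding summand[symmetric] using permutes_mem[OF that] by (intro prod.cong) auto
  then have "det ?M = (\<Sum>p\<in>{p. p permutes {0..<r}}.
      signof p * (if \<forall>k<r. e k \<le> e' (p k) then monom 1 (E p) else 0))"
    by (subst det_def'[of _ r]) auto
  then have "coeff (det ?M) (E id) = (\<Sum>p\<in>{p. p permutes {0..<r}}.
      coeff (signof p * (if \<forall>k<r. e k \<le> e' (p k) then monom 1 (E p) else 0)) (E id))"
    by (simp add: coeff_sum)
  also have "\<dots> = (\<Sum>p\<in>{p. p permutes {0..<r}}. if p = id then 1 else 0)"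
  proof (rule sum.cong)
    fix p assume "p \<in> {p. p permutes {0..<r}}"
    then show "coeff (signof p * (if \<forall>k<r. e k \<le> e' (p k) then monom 1 (E p) else 0)) (E id)
        = (if p = id then 1 else 0)"
      using E_id[of p] le by (cases "p = id") (auto simp: sign_def)
  qed simp
  also have "\<dots> = 1"
    using permutes_id[of "{0..<r}"] by (simp add: finite_permutations)
  finally show ?thesis by auto
qed

lemma poly_generic_minor:
  "poly (det (mat r r (\<lambda>(k, l). generic_entry (monom 1 1) (e k) (e' l)))) x
    = det (mat r r (\<lambda>(k, l). generic_entry (x :: complex) (e k) (e' l)))"
proof -
  have "poly (generic_entry (monom 1 1) a c) x = generic_entry x a c" for a c
    by (simp add: generic_entry_def poly_monom)
  moreover have "poly (signof p) x = (signof p :: complex)" for p :: "nat \<Rightarrow> nat"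
    by (simp add: sign_def)
  moreover have "(\<Prod>k = 0..<r. mat r r (\<lambda>(k, l). generic_entry y (e k) (e' l)) $$ (k, p k))
      = (\<Prod>k = 0..<r. generic_entry y (e k) (e' (p k)))"
    if "p permutes {0..<r}" for p and y :: "'b :: comm_ring_1"
    using permutes_mem[OF that] by (intro prod.cong) auto
  ultimately show ?thesis
    by (simp add: det_def'[of _ r] poly_sum poly_prod)
qed

text \<open>
  Avoid the finitely many roots of the product of all the minors, together with \<open>0\<close>,
  which would make the diagonal entries vanish.
\<close>

lemma ex_generic_parameter:
  fixes e :: "nat \<Rightarrow> nat \<Rightarrow> nat" and e' :: "nat \<Rightarrow> nat"
  assumes "\<And>m. m < n \<Longrightarrow> inj_on (e m) {..<r}" "inj_on e' {..<r}"
    and "\<And>m k. m < n \<Longrightarrow> k < r \<Longrightarrow> e m k \<le> e' k"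
  obtains x :: complex where "x \<noteq> 0"
    "\<And>m. m < n \<Longrightarrow> det (mat r r (\<lambda>(k, l). generic_entry x (e m k) (e' l))) \<noteq> 0"
proof -
  let ?Q = "\<lambda>m. det (mat r r (\<lambda>(k, l). generic_entry (monom (1 :: complex) 1) (e m k) (e' l)))"
  define R where "R = monom (1 :: complex) 1 * (\<Prod>m<n. ?Q m)"
  have "R \<noteq> 0"
    using generic_minor_poly_nonzero[OF assms] by (simp add: R_def)
  then have "finite {x. poly R x = 0}" by (rule poly_roots_finite)
  then obtain x where "poly R x \<noteq> 0"
    using ex_new_if_finite[OF infinite_UNIV_char_0] by blast
  then show thesis
    using that[of x] by (auto simp: R_def poly_monom poly_prod poly_generic_minor[unfolded One_nat_def])
qed

lemma ex_SL_multiple: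
  assumes A: "A \<in> carrier_mat n n" and d: "det A \<noteq> 0" and n: "n > 0"
  obtains c where "c \<noteq> 0" "c \<cdot>\<^sub>m A \<in> carrier (SL n)"
proof -
  have "card {z. z ^ n = inverse (det A)} = n"
    by (rule card_nth_roots) (use d n in auto)
  with n have "{z. z ^ n = inverse (det A)} \<noteq> {}" by (metis card.empty less_irrefl)
  then obtain c where c: "c ^ n = inverse (det A)" by blast
  with d n have "c \<noteq> 0" by (auto simp: power_0_left)
  with c A d that[of c] show thesis by (simp add: SL_iff)
qed

lemma det_permutation_mat_nonzero:
  assumes u: "u permutes {1..n}"
  shows "det (mat n n (\<lambda>(i, m). if Suc i = u (Suc m) then 1 else 0 :: complex)) \<noteq> 0"
proof -
  let ?N = "mat n n (\<lambda>(i, m). if Suc i = u (Suc m) then 1 else 0 :: complex)"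
  have "transpose_mat ?N * ?N = 1\<^sub>m n"
  proof (rule eq_matI)
    fix i j assume "i < dim_row (1\<^sub>m n)" "j < dim_col (1\<^sub>m n)"
    then have ij: "i < n" "j < n" by auto
    have "u (Suc i) \<in> {1..n}" by (rule permutes_mem[OF u]) (use ij in auto)
    then obtain a where a: "u (Suc i) = Suc a" "a < n" by (cases "u (Suc i)") auto
    have "(transpose_mat ?N * ?N) $$ (i, j) = (\<Sum>k<n. transpose_mat ?N $$ (i, k) * ?N $$ (k, j))"
      using ij by (intro index_mult_mat_sum) auto
    also have "\<dots> = (\<Sum>k<n. if k = a then if Suc a = u (Suc j) then 1 else 0 else 0)"
      by (rule sum.cong) (use ij a in auto)
    also have "\<dots> = 1\<^sub>m n $$ (i, j)"
      using inj_eq[OF permutes_inj[OF u], of "Suc i" "Suc j"] a ij by auto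
    finally show "(transpose_mat ?N * ?N) $$ (i, j) = 1\<^sub>m n $$ (i, j)" .
  qed auto
  then have "det (transpose_mat ?N) * det ?N = 1"
    by (subst det_mult[of _ n, symmetric]) auto
  then show ?thesis by auto
qed

text \<open>
  The witness is the point \<open>b n\<^sub>u P\<close> with generic upper triangular
  \<open>b\<close>.  The \<open>m\<close>-th minor of \<open>b n\<^sub>u\<close> is, up to a
  nonzero scalar, the minor of \<open>b\<close> with rows \<open>balanced_row n r m\<close> and
  columns \<open>balanced_row n r (n - 1)\<close>.  As \<open>m \<le> n - 1\<close>, these rows
  are componentwise at most these columns.
\<close>

lemma semistable_balanced:
  assumes u: "u permutes {1..n}" and r: "0 < r" "r \<le> n"
    and u_row: "\<And>l. l < r \<Longrightarrow> u (Suc l) = Suc (balanced_row n r (n - 1) l)"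
  shows "semistable n r u (torus n) \<noteq> {}"
proof -
  let ?e = "balanced_row n r" and ?e' = "balanced_row n r (n - 1)"
  have n: "0 < n" using r by simp
  have inj: "inj_on (?e m) {..<r}" for m
    by (rule strict_mono_on_imp_inj_on, rule strict_mono_onI) (use balanced_row_strict_mono[OF r] in auto)
  have "?e m k \<le> ?e' k" if "m < n" for m k
    unfolding balanced_row_def using that by (intro div_le_mono) auto
  then obtain x :: complex where x: "x \<noteq> 0"
    "\<And>m. m < n \<Longrightarrow> det (mat r r (\<lambda>(k, l). generic_entry x (?e m k) (?e' l))) \<noteq> 0"
    using ex_generic_parameter[of n ?e r ?e'] inj by blast
  define b where "b = mat n n (\<lambda>(a, c). generic_entry x a c)"
  have bc: "b \<in> carrier_mat n n" and bu: "upper_triangular b"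
    by (auto simp: b_def upper_triangular_def generic_entry_def)
  have "det b \<noteq> 0"
    unfolding det_upper_triangular_prod[OF bu bc] using x(1) by (auto simp: b_def generic_entry_def)
  then obtain \<beta> where \<beta>: "\<beta> \<noteq> 0" "\<beta> \<cdot>\<^sub>m b \<in> carrier (SL n)"
    using ex_SL_multiple[OF bc _ n] by blast
  define N where "N = mat n n (\<lambda>(i, m). if Suc i = u (Suc m) then 1 else 0 :: complex)"
  have Nc: "N \<in> carrier_mat n n" by (simp add: N_def)
  obtain \<nu> where \<nu>: "\<nu> \<noteq> 0" "\<nu> \<cdot>\<^sub>m N \<in> carrier (SL n)"
    using ex_SL_multiple[OF Nc _ n] det_permutation_mat_nonzero[OF u] unfolding N_def by blast
  let ?b = "\<beta> \<cdot>\<^sub>m b" and ?N = "\<nu> \<cdot>\<^sub>m N"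
  have entry: "(?b * ?N) $$ (i, l) = \<beta> * \<nu> * generic_entry x i (?e' l)" if "i < n" "l < r" for i l
  proof -
    have e': "?e' l < n" using n that by (intro balanced_row_less) auto
    have "(?b * ?N) $$ (i, l) = (\<Sum>k<n. ?b $$ (i, k) * ?N $$ (k, l))"
      using that r bc Nc by (intro index_mult_mat_sum) auto
    also have "\<dots> = (\<Sum>k<n. if k = ?e' l then \<beta> * \<nu> * generic_entry x i (?e' l) else 0)"
      using that r u_row[OF that(2)] by (intro sum.cong) (auto simp: b_def N_def)
    finally show ?thesis using e' by simp
  qed
  have "first_cols_minor r (?e m) (?b * ?N) \<noteq> 0" if m: "m < n" for m
  proof -
    have "mat r r (\<lambda>(k, l). (?b * ?N) $$ (?e m k, l))
      = (\<beta> * \<nu>) \<cdot>\<^sub>m mat r r (\<lambda>(k, l). generic_entry x (?e m k) (?e' l))"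
      using entry balanced_row_less[OF m]
      by (intro eq_matI) (auto simp del: index_mult_mat(1))
    then show ?thesis
      using x(2)[OF m] \<beta> \<nu> by (simp add: first_cols_minor_def)
  qed
  then have "balanced_section n r (proj n (?b * ?N)) \<noteq> 0"
    using \<beta> \<nu> r by (simp add: balanced_section_proj SL_mult_closed balanced_product_def)
  moreover have "proj n ?b \<in> borel n"
    using \<beta> bu bc by (auto simp: borel_def upper_triangular_def)
  moreover have "proj n ?N \<in> weyl_coset n u"
  proof -
    have "?N $$ (i - 1, j - 1) \<noteq> 0 \<longleftrightarrow> i = u j" if "i \<in> {1..n}" "j \<in> {1..n}" for i j
      using that \<nu> by (auto simp: N_def split: if_splits)
    with \<nu> show ?thesis by (auto simp: weyl_coset_def)
  qed
  moreover have "proj n (?b * ?N) = proj n ?b \<otimes>\<^bsub>PSL n\<^esub> proj n ?N"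
    using \<beta> \<nu> by (simp add: proj_mult)
  ultimately have "flag_point n r (proj n (?b * ?N)) \<in> schubert_variety n r u"
    using schubert_cell_subset_variety[of n r u] unfolding schubert_cell_def set_mult_def by force
  moreover have "proj n (?b * ?N) \<in> flag_point n r (proj n (?b * ?N))"
    using \<beta> \<nu> by (intro flag_point_self) (auto simp: carrier_PSL SL_mult_closed)
  ultimately have "flag_point n r (proj n (?b * ?N)) \<in> semistable n r u (torus n)"
    using bundle_section_balanced[OF r, of u] invariant_section_balanced[OF r, of u]
      \<open>balanced_section n r (proj n (?b * ?N)) \<noteq> 0\<close>
    unfolding semistable_def by blast
  then show ?thesis by blast
qed

lemma balanced_row_le_iff:
  assumes "0 < r" "0 < n"
  shows "Suc (balanced_row n r (n - 1) k) \<le> j \<longleftrightarrow> k < r * j div n"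
proof -
  have "Suc (balanced_row n r (n - 1) k) \<le> j \<longleftrightarrow> k * n + (n - 1) < j * r"
    using assms by (simp add: balanced_row_def Suc_le_eq div_less_iff_less_mult)
  also have "\<dots> \<longleftrightarrow> Suc k * n \<le> r * j"
    using assms(2) by (auto simp: mult.commute)
  also have "\<dots> \<longleftrightarrow> k < r * j div n"
    using assms(2) by (simp only: Suc_le_eq[symmetric] less_eq_div_iff_mult_less_eq)
  finally show ?thesis .
qed

lemma rank_upto_balanced:
  assumes r: "0 < r" "r \<le> n" and j: "j \<le> n"
  shows "rank_upto ((\<lambda>k. Suc (balanced_row n r (n - 1) k)) ` {..<r}) j = r * j div n"
proof -
  let ?e = "\<lambda>k. Suc (balanced_row n r (n - 1) k)"
  have n: "0 < n" using r by simp
  have "r * j div n \<le> r * n div n" using j by (intro div_le_mono mult_le_mono2)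
  then have "r * j div n \<le> r" using n by simp
  then have "{x \<in> ?e ` {..<r}. x \<le> j} = ?e ` {..<r * j div n}"
    using balanced_row_le_iff[OF r(1) n] by force
  moreover have "inj_on ?e {..<r * j div n}"
    by (rule strict_mono_on_imp_inj_on, rule strict_mono_onI)
      (use balanced_row_strict_mono[OF r] in auto)
  ultimately show ?thesis by (simp add: rank_upto_def card_image)
qed

section \<open>The minimal representative is determined at its peaks\<close>

lemma min_reps_image:
  assumes "v \<in> min_reps n r" "r \<le> n"
  shows "v permutes {1..n}" "v ` {1..r} \<subseteq> {1..n}" "card (v ` {1..r}) = r"
proof -
  show v: "v permutes {1..n}" using assms(1) by (simp add: min_reps_def sym_group_carrier)
  show "v ` {1..r} \<subseteq> {1..n}" using permutes_mem[OF v] assms(2) by fastforce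
  show "card (v ` {1..r}) = r"
    using card_image[OF inj_on_subset[OF permutes_inj[OF v]], of "{1..r}"] by simp
qed

lemma rank_upto_leI:
  assumes U: "U \<subseteq> {1..n}" and V: "V \<subseteq> {1..n}" and card: "card U = card V"
    and le: "\<And>j. j \<in> {1..n-1} \<Longrightarrow> rank_upto V j \<le> rank_upto U j"
  shows "rank_upto V j \<le> rank_upto U j"
proof -
  consider "j = 0" | "j \<in> {1..n-1}" | "n \<le> j" by fastforce
  then show ?thesis
  proof cases
    case 3
    then have "U \<subseteq> {1..j}" "V \<subseteq> {1..j}" using U V by auto
    then show ?thesis using card by (simp add: rank_upto_full)
  qed (use le V in \<open>simp_all add: rank_upto_0\<close>)
qed

text \<open>
  At a first violation, \<open>w\<close> cannot have an element.  The violation persists until the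
  next element of \<open>w\<close>, just before which there is a peak.  There is such an element,
  since otherwise the count of \<open>w\<close> would already be \<open>r\<close>.
\<close>

lemma rank_upto_le_if_peaks:
  assumes wm: "w \<in> min_reps n r" and r: "r \<le> n"
    and V: "V \<subseteq> {1..n}" "card V = r"
    and le: "\<And>j. j \<in> peaks n w \<Longrightarrow> rank_upto V j \<le> rank_upto (w ` {1..r}) j"
  shows "rank_upto V j \<le> rank_upto (w ` {1..r}) j"
proof (induction j)
  case 0
  show ?case using V by (simp add: rank_upto_0)
next
  case (Suc i)
  let ?W = "w ` {1..r}" and ?j = "Suc i"
  have w: "w permutes {1..n}" and W: "?W \<subseteq> {1..n}" "card ?W = r"
    by (rule min_reps_image[OF wm r])+
  have fin: "finite V" "finite ?W" using finite_subset[OF V(1)] by auto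
  show ?case
  proof (rule ccontr)
    assume viol: "\<not> ?thesis"
    then have notin: "?j \<notin> ?W"
      using Suc fin by (auto simp: rank_upto_Suc split: if_splits)
    have VW: "rank_upto ?W ?j < rank_upto V ?j" using viol by simp
    have "{z \<in> ?W. ?j < z} \<noteq> {}"
    proof
      assume "{z \<in> ?W. ?j < z} = {}"
      then have "{z \<in> ?W. z \<le> ?j} = ?W" by (auto simp: not_less)
      then have "rank_upto ?W ?j = r" using W by (simp add: rank_upto_def)
      moreover have "rank_upto V ?j \<le> r"
        unfolding rank_upto_def V(2)[symmetric] using fin(1) by (intro card_mono) auto
      ultimately show False using VW by simp
    qed
    define m where "m = Min {z \<in> ?W. ?j < z}"
    have m: "m \<in> ?W" "?j < m" and mmin: "\<And>z. z \<in> ?W \<Longrightarrow> ?j < z \<Longrightarrow> m \<le> z"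
      using Min_in[OF _ \<open>{z \<in> ?W. ?j < z} \<noteq> {}\<close>] fin(2) unfolding m_def by auto
    \<comment> \<open>\<open>m\<close> is the next element of \<open>w\<close> after the violation, so \<open>a\<close> is the peak in front of it.\<close>
    define a where "a = m - 1"
    have a: "m = a + 1" "?j \<le> a" using m(2) by (auto simp: a_def)
    have gap: "z \<notin> ?W" if "?j < z" "z \<le> a" for z using mmin[of z] that a by auto
    have "a \<notin> ?W" using gap[of a] notin a(2) by (cases "a = ?j") auto
    obtain x where x: "x \<in> {1..r}" "w x = a + 1" using m(1) a(1) by auto
    have "m \<in> {1..n}" using m(1) W(1) by blast
    then have an: "a \<in> {1..n}" using a by auto
    define y where "y = inv' w a"
    have y: "w y = a" "y \<in> {1..n}"
      using permutes_mem[OF permutes_inv[OF w] an] by (simp_all add: y_def permutes_inverses[OF w])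
    with \<open>a \<notin> ?W\<close> have "y \<notin> {1..r}" by blast
    with x y(2) r have "x < y" "x \<in> {1..n}" by auto
    with peaksI[OF w _ x(2) y(2,1)] have "a \<in> peaks n w" by blast
    then have "rank_upto V a \<le> rank_upto ?W a" by (rule le)
    moreover have "z \<le> a \<longleftrightarrow> z \<le> ?j" if "z \<in> ?W" for z
      using gap[of z] a(2) that by (meson le_trans not_le)
    then have "{z \<in> ?W. z \<le> a} = {z \<in> ?W. z \<le> ?j}" by blast
    then have "rank_upto ?W a = rank_upto ?W ?j" by (simp add: rank_upto_def)
    moreover have "rank_upto V ?j \<le> rank_upto V a" by (rule rank_upto_mono[OF fin(1) a(2)])
    ultimately show False using VW by simp
  qed
qed

lemma unique_minimalI:
  assumes "w \<in> A" "\<And>v. v \<in> A \<Longrightarrow> bruhat_le n w v"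
  shows "unique_minimal (bruhat_le n) A w"
  using assms bruhat_le_antisym unfolding unique_minimal_def minimal_elements_def by blast

theorem lemma3p2:
  fixes n r :: nat and w :: "nat \<Rightarrow> nat"
  assumes "1 \<le> r" and "r \<le> n - 1" and "gcd r n = 1"
    and "unique_minimal (bruhat_le n)
           {v \<in> min_reps n r. semistable n r v (torus n) \<noteq> {}} w"
  shows "unique_minimal (bruhat_le n)
           {v \<in> min_reps n r. semistable n r v (subtorus n (peaks n w)) \<noteq> {}} w"
proof -
  have r: "0 < r" "r \<le> n" and n: "0 < n" using assms(1,2) by auto
  have w: "w \<in> min_reps n r" "semistable n r w (torus n) \<noteq> {}"
    and w_min: "\<And>v. v \<in> min_reps n r \<Longrightarrow> semistable n r v (torus n) \<noteq> {} \<Longrightarrow> bruhat_le n v w \<Longrightarrow> v = w"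
    using assms(4) by (auto simp: unique_minimal_def minimal_elements_def)
  note w_props = min_reps_image[OF w(1) r(2)]
  let ?e = "\<lambda>k. Suc (balanced_row n r (n - 1) k)"
  \<comment> \<open>The set of the largest of the Pluecker coordinates; rows are counted from \<open>0\<close> and values of permutations from \<open>1\<close>.\<close>
  let ?U = "?e ` {..<r}"
  have inj: "inj_on ?e {..<r}"
    by (rule strict_mono_on_imp_inj_on, rule strict_mono_onI)
      (use balanced_row_strict_mono[OF r] in auto)
  have "?U \<subseteq> {1..n}" using balanced_row_less[of "n - 1" n _ r] n by (auto simp: Suc_le_eq)
  moreover have "card ?U = r" using card_image[OF inj] by simp
  ultimately obtain u where u: "u \<in> min_reps n r" "u ` {1..r} = ?U" by (rule ex_min_rep)
  note u_props = min_reps_image[OF u(1) r(2)]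
  have "u l = ?e (l - 1)" if "l \<in> {1..r}" for l
  proof (rule strict_mono_on_eqI[of "{1..r}" u "\<lambda>l. ?e (l - 1)"])
    show "strict_mono_on {1..r} u"
      using min_reps_grassmannian[OF u(1) r(2)] by (simp add: grassmannian_def)
    show "strict_mono_on {1..r} (\<lambda>l. ?e (l - 1))"
      by (rule strict_mono_onI) (use balanced_row_strict_mono[OF r] in auto)
    have "(\<lambda>l. l - 1) ` {1..r} = {..<r}"
      by (force simp: image_iff intro: bexI[of _ "Suc _"])
    then show "u ` {1..r} = (\<lambda>l. ?e (l - 1)) ` {1..r}"
      unfolding u(2) by (metis (no_types) image_image)
  qed (use that in auto)
  then have u_ss: "semistable n r u (torus n) \<noteq> {}"
    by (intro semistable_balanced[OF u_props(1) r]) auto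
  have u_rank: "rank_upto ?U j = r * j div n" if "j \<in> {1..n-1}" for j
    using rank_upto_balanced[OF r] that by auto
  have "rank_upto (w ` {1..r}) j \<le> rank_upto (u ` {1..r}) j" for j
  proof (rule rank_upto_leI[OF u_props(2) w_props(2)])
    fix j assume j: "j \<in> {1..n-1}"
    have "n * rank_upto (w ` {1..r}) j \<le> r * j"
      using simple_root_cochar(1)[OF j j] by (rule semistable_rank_bound[OF w_props(1) r(2) j _ w(2)])
    then show "rank_upto (w ` {1..r}) j \<le> rank_upto (u ` {1..r}) j"
      unfolding u(2) u_rank[OF j] using n by (simp add: less_eq_div_iff_mult_less_eq mult.commute)
  qed (simp only: u_props(3) w_props(3))
  then have "bruhat_le n u w"
    using min_reps_grassmannian[OF u(1) r(2)] min_reps_grassmannian[OF w(1) r(2)] r(2)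
    by (intro grassmannian_bruhat_le)
  then have uw: "u = w" using u(1) u_ss by (intro w_min)
  show ?thesis
  proof (rule unique_minimalI)
    show "w \<in> {v \<in> min_reps n r. semistable n r v (subtorus n (peaks n w)) \<noteq> {}}"
      using w semistable_antimono[OF subtorus_subset_torus[OF peaks_subset]] by blast
  next
    fix v assume "v \<in> {v \<in> min_reps n r. semistable n r v (subtorus n (peaks n w)) \<noteq> {}}"
    then have v: "v \<in> min_reps n r" "semistable n r v (subtorus n (peaks n w)) \<noteq> {}" by auto
    note v_props = min_reps_image[OF v(1) r(2)]
    have "rank_upto (v ` {1..r}) j \<le> rank_upto (w ` {1..r}) j" for j
    proof (rule rank_upto_le_if_peaks[OF w(1) r(2) v_props(2,3)])
      fix j assume peak: "j \<in> peaks n w"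
      then have j: "j \<in> {1..n-1}" using peaks_subset by blast
      have "cochar n j t \<in> subtorus n (peaks n w)" if "t \<noteq> 0" for t
        unfolding subtorus_def using peak that by (intro generate.incl) auto
      then have "n * rank_upto (v ` {1..r}) j \<le> r * j"
        by (rule semistable_rank_bound[OF v_props(1) r(2) j _ v(2)])
      then show "rank_upto (v ` {1..r}) j \<le> rank_upto (w ` {1..r}) j"
        unfolding uw[symmetric] u(2) u_rank[OF j] using n
        by (simp add: less_eq_div_iff_mult_less_eq mult.commute)
    qed
    then show "bruhat_le n w v"
      using min_reps_grassmannian[OF v(1) r(2)] min_reps_grassmannian[OF w(1) r(2)] r(2)
      by (intro grassmannian_bruhat_le)
  qed
qed

end
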